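(* The solution, in the sense of formal power series $X=\sum_{j\ge0}(-\lambda)^jX_j$, of the stochastic differential equation $\partial_tX=\Delta X-m_0^2X-\lambda X^p+\eta$ ($t>0$), $X(0,\cdot)=f$, is given by a sum over rooted trees: $$X_j(x,\eta)=\sum_{T\in\mathcal A(j)}\mathcal B(T,x,\eta),\qquad x\in\Gamma,\ j\ge0 .$$
   Context: Fix integers $d,p\ge1$ and reals $\delta>0$, $m_0>0$. Let $L_\delta=\delta\mathbb Z^d$ and $\Gamma=\mathbb R\times L_\delta$, with points $x=(t,\mathbf x)$ and $|x|^2=t^2+|\mathbf x|^2$. Put $\int g(\mathbf x)\,d\mathbf x=\sum_{\mathbf x\in L_\delta}\delta^dg(\mathbf x)$ and $\int g(x)\,dx=\sum_{\mathbf x\in L_\delta}\delta^d\int_{\mathbb R}g(t,\mathbf x)\,dt$. Convolutions: $(g*h)(x)=\int g(x-y)h(y)\,dy$ on $\Gamma$ and $(g\star h)(\mathbf x)=\int g(\mathbf x-\mathbf y)h(\mathbf y)\,d\mathbf y$ on $L_\delta$. Lattice Laplacian: $\Delta g(\mathbf x)=\delta^{-2}\big[-2d\,g(\mathbf x)+\sum_{|\mathbf y-\mathbf x|=\delta}g(\mathbf y)\big]$. Let $\mu^2(\mathbf p)=2\delta^{-2}\big(d-\sum_{j=1}^d\cos(\delta p_j)\big)+m_0^2$, $\tilde G_t(\mathbf x)=(2\pi)^{-d}\int_{[0,2\pi/\delta]^d}e^{-i\mathbf p\cdot\mathbf x}e^{-t\mu^2(\mathbf p)}\,d\mathbf p$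 for $t\ge0$, and $G(t,\mathbf x)=\theta(t)\tilde G_t(\mathbf x)$ with $\theta(t)=1$ if $t>0$ and $\theta(t)=0$ otherwise. Noise and solution. $f\in S(L_\delta)$ (rapidly decreasing functions). The noise $\eta$ is a random tempered distribution on $\Gamma$ supported in $\{t\ge0\}$ such that $G*\eta\in\mathcal M_b$ almost surely, where $\mathcal M_b$ is the space of measurable $g:\Gamma\to\mathbb R$ such that for every $k\in\mathbb N$ there is $N\in\mathbb N$ with $\int|g(x)|^k(1+|x|^2)^{-N}dx<\infty$. The formal power series solution $X=\sum_{j\ge0}(-\lambda)^jX_j$ is the one solving $X=-\lambda G*(X^p)+G*\eta+\tilde G_t\star f$ order by order ($\tilde G_t\star f$ being set to $0$ for $t\le0$), i.e. $X_0=G*\eta+\tilde G_t\star f$ and, for $j\ge1$, $X_j=G*\sum\frac{p!}{n_0!n_1!\cdots}\prod_{i\ge0}X_i^{n_i}$, the sum running over nonnegative integers $n_0,n_1,\dots$ with $\sum_in_i=p$, $\sum_i i\,n_i=j-1$. Write $X_j(x,\eta)$ for its value at $x$. Trees. $\mathcal A(j)$ is the set of rooted trees with a root $x$ of degree one, $j$ inner vertices each having $p+1$ legs, all other vertices being leaves of degree one, each leaf being either of type one or of type two. $\mathcal A(0)$ has two elements: the root joined to a single leaf of type one, respectively of type two. For $j\ge1$, a tree $T\in\mathcal A(j)$ is obtained by joining the root to an inner vertex $v_0$ to which $p$ rooted trees with root $v_0$ are attached, $n_i$ of them from $\mathcal A(i)$, with $\sum_in_i=p$ and $\sum_i i\,n_i=j-1$.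 $T$ is specified by the $n_i$, by the number $n_0'\le n_0$ of attached elements of $\mathcal A(0)$ whose leaf is of type one, and, for each $i\ge1$, by the list $(T_{i,1},\dots,T_{i,n_i})$ of attached elements of $\mathcal A(i)$; the order of the attached elements of $\mathcal A(0)$ is immaterial, while for $i\ge1$ different lists give different elements of $\mathcal A(j)$. For vertices, $v\le w$ means every walk from $w$ to the root passes through $v$. Multiplicity. For an inner vertex $v$, $M(v)=\frac{p!}{n_0'!\,(n_0-n_0')!\,n_1!\,n_2!\cdots}$, where $n_i$ is the number of rooted subtrees attached at $v$ (away from the root) with $i$ inner vertices, and $n_0'$ the number of those with no inner vertex and a leaf of type one. $M(T)=\prod_vM(v)$ over the inner vertices of $T$. Value. $\mathcal B(T,x,\eta)$ is obtained by assigning $x$ to the root, variables $y_1,\dots,y_j\in\Gamma$ to the inner vertices, $z_1,\dots,z_k\in\Gamma$ to the leaves of type one and $\mathbf z_1',\dots,\mathbf z_l'\in L_\delta$ to the leaves of type two (placed at $(0,\mathbf z'_r)\in\Gamma$), and setting $$\mathcal B(T,x,\eta)=M(T)\int\prod_{e}G(e)\prod_{r=1}^k\eta(z_r)\prod_{r=1}^lf(\mathbf z_r')\,dy_1\cdots dy_j\,dz_1\cdots dz_k\,d\mathbf z_1'\cdots d\mathbf z_l',$$ where $G(e)=G(v-w)$ for an edge $e=\{v,w\}$ with $v\le w$. The integral over a leaf of type one attached to $v$ means the factor $(G*\eta)(v)$. *)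

theory Defs
  imports "HOL-Probability.Probability"
begin

section \<open>The lattice and space-time\<close>

text \<open>The dimension \<open>d\<close> is \<open>CARD('d)\<close>. Functions on \<open>\<delta>\<int>\<^sup>d\<close> and on \<open>\<real> \<times> \<delta>\<int>\<^sup>d\<close> are functions on the
  ambient space \<open>real^'d\<close> resp. \<open>real \<times> (real^'d)\<close>; only their values on \<^term>\<open>lat \<delta>\<close> resp.
  \<^term>\<open>spacetime \<delta>\<close> matter. The norm of \<open>(t, x)\<close> in the product type is \<open>sqrt (t\<^sup>2 + |x|\<^sup>2)\<close>.\<close>

definition lat :: "real \<Rightarrow> (real^'d) set" where
  "lat \<delta> = {x. \<forall>i. \<exists>k::int. x $ i = \<delta> * of_int k}"

definition spacetime :: "real \<Rightarrow> (real \<times> (real^'d)) set" where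
  "spacetime \<delta> = UNIV \<times> lat \<delta>"

definition lat_measure :: "real \<Rightarrow> (real^'d) measure" where
  "lat_measure \<delta> = scale_measure (ennreal (\<delta> ^ CARD('d))) (count_space (lat \<delta>))"

definition spacetime_measure :: "real \<Rightarrow> (real \<times> (real^'d)) measure" where
  "spacetime_measure \<delta> = lborel \<Otimes>\<^sub>M lat_measure \<delta>"

definition conv ::
  "real \<Rightarrow> (real \<times> (real^'d) \<Rightarrow> real) \<Rightarrow> (real \<times> (real^'d) \<Rightarrow> real) \<Rightarrow> real \<times> (real^'d) \<Rightarrow> real" where
  "conv \<delta> g h x = (\<integral>y. g (x - y) * h y \<partial>spacetime_measure \<delta>)"

definition lat_conv ::
  "real \<Rightarrow> (real^'d \<Rightarrow> real) \<Rightarrow> (real^'d \<Rightarrow> real) \<Rightarrow> real^'d \<Rightarrow> real" where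
  "lat_conv \<delta> g h x = (\<integral>y. g (x - y) * h y \<partial>lat_measure \<delta>)"


section \<open>The Green function\<close>

definition mu_sq :: "real \<Rightarrow> real \<Rightarrow> real^'d \<Rightarrow> real" where
  "mu_sq \<delta> m0 p = 2 / \<delta>\<^sup>2 * (real CARD('d) - (\<Sum>i\<in>UNIV. cos (\<delta> * p $ i))) + m0\<^sup>2"

text \<open>For \<open>x \<in> \<delta>\<int>\<^sup>d\<close> the integral below is a real number, because \<^const>\<open>mu_sq\<close> is even and
  \<open>2\<pi>/\<delta>\<close>-periodic in each coordinate; \<^const>\<open>Re\<close> only changes its type.\<close>

definition heat_kernel :: "real \<Rightarrow> real \<Rightarrow> real \<Rightarrow> real^'d \<Rightarrow> real" where
  "heat_kernel \<delta> m0 t x =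
     Re ((LINT p : cbox 0 (\<chi> i. 2 * pi / \<delta>) | lborel.
            exp (- \<i> * of_real (p \<bullet> x)) * of_real (exp (- t * mu_sq \<delta> m0 p)))
         / (2 * of_real pi) ^ CARD('d))"

definition green :: "real \<Rightarrow> real \<Rightarrow> real \<times> (real^'d) \<Rightarrow> real" where
  "green \<delta> m0 = (\<lambda>(t, x). if t > 0 then heat_kernel \<delta> m0 t x else 0)"


section \<open>Function spaces and tempered distributions\<close>

definition rapidly_decreasing :: "real \<Rightarrow> (real^'d \<Rightarrow> real) \<Rightarrow> bool" where
  "rapidly_decreasing \<delta> f \<longleftrightarrow>
     (\<forall>N::nat. bounded ((\<lambda>x. (1 + (norm x)\<^sup>2) ^ N * f x) ` lat \<delta>))"

definition M_b :: "real \<Rightarrow> (real \<times> (real^'d) \<Rightarrow> real) set" where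
  "M_b \<delta> = {g \<in> borel_measurable (spacetime_measure \<delta>).
     \<forall>k::nat. \<exists>N::nat. integrable (spacetime_measure \<delta>) (\<lambda>x. \<bar>g x\<bar> ^ k / (1 + (norm x)\<^sup>2) ^ N)}"

definition time_deriv :: "nat \<Rightarrow> (real \<times> (real^'d) \<Rightarrow> real) \<Rightarrow> real \<times> (real^'d) \<Rightarrow> real" where
  "time_deriv m \<phi> = (\<lambda>(t, x). (deriv ^^ m) (\<lambda>s. \<phi> (s, x)) t)"

text \<open>The Schwartz space of \<open>\<real> \<times> \<delta>\<int>\<^sup>d\<close>: smoothness concerns the time variable only. Extending test
  functions by \<open>0\<close> off space-time makes a functional on them depend only on their values there.\<close>

definition schwartz :: "real \<Rightarrow> (real \<times> (real^'d) \<Rightarrow> real) set" where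
  "schwartz \<delta> = {\<phi>.
     (\<forall>x. x \<notin> spacetime \<delta> \<longrightarrow> \<phi> x = 0) \<and>
     (\<forall>m t. \<forall>x\<in>lat \<delta>. (\<lambda>s. time_deriv m \<phi> (s, x)) field_differentiable (at t)) \<and>
     (\<forall>m N::nat. bounded ((\<lambda>x. (1 + (norm x)\<^sup>2) ^ N * time_deriv m \<phi> x) ` spacetime \<delta>))}"

definition schwartz_seminorm :: "real \<Rightarrow> nat \<Rightarrow> nat \<Rightarrow> (real \<times> (real^'d) \<Rightarrow> real) \<Rightarrow> real" where
  "schwartz_seminorm \<delta> m N \<phi> =
     (SUP x\<in>spacetime \<delta>. (1 + (norm x)\<^sup>2) ^ N * \<bar>time_deriv m \<phi> x\<bar>)"

text \<open>The Schwartz space is metrizable, so continuity of a linear functional is sequential continuity.\<close>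

definition tempered_distribution :: "real \<Rightarrow> ((real \<times> (real^'d) \<Rightarrow> real) \<Rightarrow> real) \<Rightarrow> bool" where
  "tempered_distribution \<delta> u \<longleftrightarrow>
     (\<forall>\<phi>\<in>schwartz \<delta>. \<forall>\<psi>\<in>schwartz \<delta>. \<forall>a b. u (\<lambda>x. a * \<phi> x + b * \<psi> x) = a * u \<phi> + b * u \<psi>) \<and>
     (\<forall>\<Phi> \<phi>. (\<forall>n::nat. \<Phi> n \<in> schwartz \<delta>) \<longrightarrow> \<phi> \<in> schwartz \<delta> \<longrightarrow>
        (\<forall>m N. (\<lambda>n. schwartz_seminorm \<delta> m N (\<lambda>x. \<Phi> n x - \<phi> x)) \<longlonglongrightarrow> 0) \<longrightarrow>
        (\<lambda>n. u (\<Phi> n)) \<longlonglongrightarrow> u \<phi>)"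

definition supported_in_nonneg_times :: "real \<Rightarrow> ((real \<times> (real^'d) \<Rightarrow> real) \<Rightarrow> real) \<Rightarrow> bool" where
  "supported_in_nonneg_times \<delta> u \<longleftrightarrow>
     (\<forall>\<phi>\<in>schwartz \<delta>. compact (closure {x. \<phi> x \<noteq> 0}) \<longrightarrow>
        closure {x. \<phi> x \<noteq> 0} \<inter> {x. fst x \<ge> 0} = {} \<longrightarrow> u \<phi> = 0)"

definition random_tempered_distribution ::
  "'w measure \<Rightarrow> real \<Rightarrow> ('w \<Rightarrow> (real \<times> (real^'d) \<Rightarrow> real) \<Rightarrow> real) \<Rightarrow> bool" where
  "random_tempered_distribution M \<delta> \<eta> \<longleftrightarrow>
     (\<forall>\<omega>\<in>space M. tempered_distribution \<delta> (\<eta> \<omega>)) \<and>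
     (\<forall>\<phi>\<in>schwartz \<delta>. (\<lambda>\<omega>. \<eta> \<omega> \<phi>) \<in> borel_measurable M)"

text \<open>The convolution of \<open>G\<close> with a tempered distribution \<open>u\<close> is the tempered distribution
  \<open>\<phi> \<mapsto> u (\<lambda>y. \<integral> G(x - y) \<phi>(x) dx)\<close>. The predicate says that it is given by the function \<open>g\<close>.\<close>

definition green_adjoint ::
  "real \<Rightarrow> real \<Rightarrow> (real \<times> (real^'d) \<Rightarrow> real) \<Rightarrow> real \<times> (real^'d) \<Rightarrow> real" where
  "green_adjoint \<delta> m0 \<phi> y =
     (if y \<in> spacetime \<delta> then \<integral>x. green \<delta> m0 (x - y) * \<phi> x \<partial>spacetime_measure \<delta> else 0)"

definition is_green_conv ::
  "real \<Rightarrow> real \<Rightarrow> ((real \<times> (real^'d) \<Rightarrow> real) \<Rightarrow> real) \<Rightarrow> (real \<times> (real^'d) \<Rightarrow> real) \<Rightarrow> bool" where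
  "is_green_conv \<delta> m0 u g \<longleftrightarrow>
     (\<forall>\<phi>\<in>schwartz \<delta>. u (green_adjoint \<delta> m0 \<phi>) = (\<integral>x. g x * \<phi> x \<partial>spacetime_measure \<delta>))"


section \<open>The formal power series solution\<close>

definition initial_part ::
  "real \<Rightarrow> real \<Rightarrow> (real^'d \<Rightarrow> real) \<Rightarrow> real \<times> (real^'d) \<Rightarrow> real" where
  "initial_part \<delta> m0 f = (\<lambda>(t, x). if t > 0 then lat_conv \<delta> (heat_kernel \<delta> m0 t) f x else 0)"

text \<open>Families \<open>(n\<^sub>i)\<close> with \<open>\<Sum> n\<^sub>i = p\<close> and \<open>\<Sum> i n\<^sub>i = j\<close>; the latter forces \<open>n\<^sub>i = 0\<close> for \<open>i > j\<close>.\<close>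

definition occupation_numbers :: "nat \<Rightarrow> nat \<Rightarrow> (nat \<Rightarrow> nat) set" where
  "occupation_numbers p j =
     {n. (\<forall>i>j. n i = 0) \<and> (\<Sum>i\<le>j. n i) = p \<and> (\<Sum>i\<le>j. i * n i) = j}"

text \<open>The coefficient of \<open>(-\<lambda>)\<^sup>j\<close> in the \<open>p\<close>-th power of \<open>\<Sum>\<^sub>i (-\<lambda>)\<^sup>i X\<^sub>i\<close>.\<close>

definition power_coeff :: "nat \<Rightarrow> (nat \<Rightarrow> 'a \<Rightarrow> real) \<Rightarrow> nat \<Rightarrow> 'a \<Rightarrow> real" where
  "power_coeff p X j y =
     (\<Sum>n\<in>occupation_numbers p j. fact p / (\<Prod>i\<le>j. fact (n i)) * (\<Prod>i\<le>j. X i y ^ n i))"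

lemma power_coeff_cong [fundef_cong]:
  assumes "p = q" "j = k" "\<And>i. i \<le> k \<Longrightarrow> X i = Y i"
  shows "power_coeff p X j = power_coeff q Y k"
  using assms by (intro ext) (simp add: power_coeff_def)

text \<open>Here \<open>W\<close> stands for the function \<open>G * \<eta>\<close>.\<close>

fun sol_coeff ::
  "real \<Rightarrow> real \<Rightarrow> nat \<Rightarrow> (real \<times> (real^'d) \<Rightarrow> real) \<Rightarrow> (real^'d \<Rightarrow> real) \<Rightarrow>
   nat \<Rightarrow> real \<times> (real^'d) \<Rightarrow> real" where
  "sol_coeff \<delta> m0 p W f 0 = (\<lambda>x. W x + initial_part \<delta> m0 f x)"
| "sol_coeff \<delta> m0 p W f (Suc j) =
     conv \<delta> (green \<delta> m0) (power_coeff p (\<lambda>i. sol_coeff \<delta> m0 p W f i) j)"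


section \<open>Trees\<close>

datatype leaf_type = Type_One | Type_Two

text \<open>The root, joined to a single vertex, is left implicit. In \<^term>\<open>Inner Ts\<close> that vertex is an
  inner vertex, and \<^term>\<open>Ts ! i\<close> lists the trees with \<open>i\<close> inner vertices attached to it.\<close>

datatype rtree = Leaf leaf_type | Inner "rtree list list"

text \<open>Since the order of the attached single leaves is immaterial, those of type one are put first.\<close>

inductive is_tree :: "nat \<Rightarrow> nat \<Rightarrow> rtree \<Rightarrow> bool" for p :: nat where
  Leaf: "is_tree p 0 (Leaf a)"
| Inner: "\<lbrakk>length Ts = Suc j;
           (\<Sum>i\<le>j. length (Ts ! i)) = p;
           (\<Sum>i\<le>j. i * length (Ts ! i)) = j;
           \<forall>i\<le>j. \<forall>T\<in>set (Ts ! i). is_tree p i T;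
           Ts ! 0 = replicate k (Leaf Type_One) @ replicate l (Leaf Type_Two)\<rbrakk>
          \<Longrightarrow> is_tree p (Suc j) (Inner Ts)"

definition trees_of_order :: "nat \<Rightarrow> nat \<Rightarrow> rtree set" where
  "trees_of_order p j = {T. is_tree p j T}"

text \<open>A vertex other than the root is named by the path leading to it from the neighbour \<open>[]\<close> of the
  root; a step \<open>(i, k)\<close> enters the \<open>k\<close>-th attached tree with \<open>i\<close> inner vertices. Thus the last
  vertex before \<open>u\<close> on the way from the root is \<open>butlast u\<close>, or the root if \<open>u = []\<close>.\<close>

type_synonym vertex = "(nat \<times> nat) list"

fun subtree_at :: "rtree \<Rightarrow> vertex \<Rightarrow> rtree option" where
  "subtree_at T [] = Some T"
| "subtree_at (Leaf a) (_ # u) = None"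
| "subtree_at (Inner Ts) ((i, k) # u) =
     (if i < length Ts \<and> k < length (Ts ! i) then subtree_at (Ts ! i ! k) u else None)"

definition inner_vertices :: "rtree \<Rightarrow> vertex set" where
  "inner_vertices T = {u. \<exists>Ts. subtree_at T u = Some (Inner Ts)}"

definition leaves :: "leaf_type \<Rightarrow> rtree \<Rightarrow> vertex set" where
  "leaves a T = {u. subtree_at T u = Some (Leaf a)}"

definition vertex_multiplicity :: "nat \<Rightarrow> rtree \<Rightarrow> vertex \<Rightarrow> real" where
  "vertex_multiplicity p T v =
     (case subtree_at T v of
        Some (Inner Ts) \<Rightarrow>
          fact p / (fact (count_list (Ts ! 0) (Leaf Type_One)) *
                    fact (count_list (Ts ! 0) (Leaf Type_Two)) *
                    (\<Prod>i = 1..<length Ts. fact (length (Ts ! i))))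
      | _ \<Rightarrow> 1)"

definition multiplicity :: "nat \<Rightarrow> rtree \<Rightarrow> real" where
  "multiplicity p T = (\<Prod>v\<in>inner_vertices T. vertex_multiplicity p T v)"


section \<open>The value of a tree\<close>

text \<open>The root sits at \<open>x\<close>, the inner vertex \<open>u\<close> at \<open>y u\<close>, and the leaf \<open>u\<close> of type two at \<open>(0, z u)\<close>.
  An edge is indexed by its endpoint \<open>u\<close> away from the root. The edge to a leaf of type one,
  integrated against the noise, contributes \<open>W = G * \<eta>\<close> at the other endpoint.\<close>

definition position ::
  "rtree \<Rightarrow> (vertex \<Rightarrow> real \<times> (real^'d)) \<Rightarrow> (vertex \<Rightarrow> real^'d) \<Rightarrow> vertex \<Rightarrow> real \<times> (real^'d)" where
  "position T y z u = (if u \<in> inner_vertices T then y u else (0, z u))"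

definition parent_position ::
  "real \<times> (real^'d) \<Rightarrow> (vertex \<Rightarrow> real \<times> (real^'d)) \<Rightarrow> vertex \<Rightarrow> real \<times> (real^'d)" where
  "parent_position x y u = (if u = [] then x else y (butlast u))"

definition tree_integrand ::
  "(real \<times> (real^'d) \<Rightarrow> real) \<Rightarrow> (real \<times> (real^'d) \<Rightarrow> real) \<Rightarrow> (real^'d \<Rightarrow> real) \<Rightarrow> rtree \<Rightarrow> real \<times> (real^'d) \<Rightarrow>
   (vertex \<Rightarrow> real \<times> (real^'d)) \<times> (vertex \<Rightarrow> real^'d) \<Rightarrow> real" where
  "tree_integrand G W f T x = (\<lambda>(y, z).
     (\<Prod>u\<in>inner_vertices T \<union> leaves Type_Two T. G (parent_position x y u - position T y z u)) *
     (\<Prod>u\<in>leaves Type_One T. W (parent_position x y u)) *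
     (\<Prod>u\<in>leaves Type_Two T. f (z u)))"

definition tree_measure ::
  "real \<Rightarrow> rtree \<Rightarrow> ((vertex \<Rightarrow> real \<times> (real^'d)) \<times> (vertex \<Rightarrow> real^'d)) measure" where
  "tree_measure \<delta> T =
     (\<Pi>\<^sub>M u\<in>inner_vertices T. spacetime_measure \<delta>) \<Otimes>\<^sub>M (\<Pi>\<^sub>M u\<in>leaves Type_Two T. lat_measure \<delta>)"

definition tree_value ::
  "real \<Rightarrow> real \<Rightarrow> nat \<Rightarrow> (real \<times> (real^'d) \<Rightarrow> real) \<Rightarrow> (real^'d \<Rightarrow> real) \<Rightarrow> rtree \<Rightarrow>
   real \<times> (real^'d) \<Rightarrow> real" where
  "tree_value \<delta> m0 p W f T x =
     multiplicity p T * (\<integral>yz. tree_integrand (green \<delta> m0) W f T x yz \<partial>tree_measure \<delta> T)"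

end

theory Submission
  imports Defs
begin

text \<open>The Green function \<open>G\<close> decays exponentially: expanding \<open>exp (2t\<delta>\<^sup>-\<^sup>2 \<Sum>\<^sub>j cos (\<delta>p\<^sub>j))\<close> in powers of \<open>t\<close>, the
  \<open>n\<close>-th coefficient is a sum over lattice walks with \<open>n\<close> steps, and a weight \<open>exp (-a|x|\<^sub>1/\<delta>)\<close> grows by at most
  \<open>e\<^sup>a\<close> per step; for small \<open>a\<close> this growth is absorbed by \<open>exp (-m\<^sub>0\<^sup>2 t)\<close>. Hence convolution with \<open>G\<close>, and with
  \<open>|G|\<close>, preserves the algebra \<open>M_b\<close>, which makes all tree integrals absolutely convergent. By Fubini a tree integral
  is computed recursively from the root: it is \<open>G\<close> convolved with the product of the values of the trees attached to the
  first inner vertex. Expanding the multinomial coefficients and the powers \<open>X\<^sub>i\<^sup>n\<close> over lists of trees, the sum of the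
  tree values then satisfies the recursion that defines \<open>X\<^sub>j\<close>.\<close>

section \<open>Lattice measures and the algebra \<open>M_b\<close>\<close>

text \<open>Once an outcome outside a null set is fixed, the argument is deterministic and concerns
  a function \<open>W\<close> in \<open>M_b\<close>. The obstacle is that X_j is a nest of
  convolutions while the value of a tree is a single integral over all its vertices. Exchanging the
  order of integration requires absolute integrability, and an integral that fails to converge would
  silently be 0. The way out is that the absolute value of a tree integrand is the tree integrand
  for |G|, |W| and |f|. The evaluation is therefore stated for arbitrary kernels and leaf functions,
  and each Fubini argument uses it twice: for the absolute values to get integrability, then for the
  data themselves to get the value.\<close>

lemma countable_lat: "countable (lat \<delta> :: (real^'d) set)"
proof -
  have "lat \<delta> \<subseteq> range (\<lambda>k::'d \<Rightarrow> int. \<chi> i. \<delta> * of_int (k i))"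
  proof
    fix x :: "real^'d" assume "x \<in> lat \<delta>"
    then obtain k where "\<And>i. x $ i = \<delta> * of_int (k i)" unfolding lat_def by (auto, metis)
    then have "x = (\<chi> i. \<delta> * of_int (k i))" by (simp add: vec_eq_iff)
    then show "x \<in> range (\<lambda>k::'d \<Rightarrow> int. \<chi> i. \<delta> * of_int (k i))" by blast
  qed
  then show ?thesis by (rule countable_subset) simp
qed

lemma zero_in_lat: "0 \<in> lat \<delta>"
  unfolding lat_def by (auto intro: exI[of _ 0])

lemma diff_in_lat: "x \<in> lat \<delta> \<Longrightarrow> y \<in> lat \<delta> \<Longrightarrow> x - y \<in> lat \<delta>"
  unfolding lat_def
  by (auto, metis of_int_diff right_diff_distrib)

lemma add_in_lat: "x \<in> lat \<delta> \<Longrightarrow> y \<in> lat \<delta> \<Longrightarrow> x + y \<in> lat \<delta>"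
  unfolding lat_def
  by (auto, metis of_int_add distrib_left)

lemma diff_in_spacetime: "x \<in> spacetime \<delta> \<Longrightarrow> y \<in> spacetime \<delta> \<Longrightarrow> x - y \<in> spacetime \<delta>"
  unfolding spacetime_def by (auto intro: diff_in_lat)

lemma space_lat_measure [simp]: "space (lat_measure \<delta>) = lat \<delta>"
  by (simp add: lat_measure_def space_scale_measure)

lemma sets_lat_measure: "sets (lat_measure \<delta>) = Pow (lat \<delta>)"
  by (simp add: lat_measure_def)

lemma sets_lat_measure_count [measurable_cong]: "sets (lat_measure \<delta>) = sets (count_space (lat \<delta>))"
  by (simp add: sets_lat_measure)

lemma sigma_finite_lat_measure: "sigma_finite_measure (lat_measure \<delta> :: (real^'d) measure)"
proof
  let ?A = "(\<lambda>x. {x}) ` (lat \<delta> :: (real^'d) set)"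
  have "emeasure (lat_measure \<delta>) {x} \<noteq> \<infinity>" if "x \<in> lat \<delta>" for x :: "real^'d"
    using that by (simp add: lat_measure_def ennreal_mult_eq_top_iff)
  then show "\<exists>A. countable A \<and> A \<subseteq> sets (lat_measure \<delta>) \<and> \<Union> A = space (lat_measure \<delta> :: (real^'d) measure) \<and>
      (\<forall>a\<in>A. emeasure (lat_measure \<delta>) a \<noteq> \<infinity>)"
    by (intro exI[of _ ?A]) (auto simp: countable_lat sets_lat_measure)
qed

interpretation lat: sigma_finite_measure "lat_measure \<delta> :: (real^'d) measure" for \<delta>
  by (rule sigma_finite_lat_measure)

interpretation lat_prod: product_sigma_finite "\<lambda>_. lat_measure \<delta> :: (real^'d) measure" for \<delta>
  by unfold_locales

interpretation time_lat: pair_sigma_finite "lborel :: real measure" "lat_measure \<delta> :: (real^'d) measure" for \<delta>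
  by unfold_locales

lemma space_spacetime_measure [simp]: "space (spacetime_measure \<delta>) = spacetime \<delta>"
  by (simp add: spacetime_measure_def spacetime_def space_pair_measure)

interpretation st: sigma_finite_measure "spacetime_measure \<delta> :: (real \<times> (real^'d)) measure" for \<delta>
  unfolding spacetime_measure_def by unfold_locales

interpretation st_prod: product_sigma_finite "\<lambda>_. spacetime_measure \<delta> :: (real \<times> (real^'d)) measure" for \<delta>
  by unfold_locales

text \<open>Space-time carries the Borel sets in time times all subsets of
  \<open>lat \<delta>\<close>, not the Borel sets of the ambient space, so the difference must be
  shown to stay on the lattice. For the lattice part nothing else is needed: every subset of a
  product of two countable discrete spaces is measurable.\<close>

lemma measurable_minus_spacetime:
  "(\<lambda>(x, y). x - y) \<in> spacetime_measure \<delta> \<Otimes>\<^sub>M spacetime_measure \<delta> \<rightarrow>\<^sub>M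
     (spacetime_measure \<delta> :: (real \<times> (real^'d)) measure)"
proof -
  have lat: "(\<lambda>(x, y). x - y) \<in> lat_measure \<delta> \<Otimes>\<^sub>M lat_measure \<delta> \<rightarrow>\<^sub>M (lat_measure \<delta> :: (real^'d) measure)"
  proof -
    have "sets (lat_measure \<delta> \<Otimes>\<^sub>M lat_measure \<delta> :: ((real^'d) \<times> (real^'d)) measure) = Pow (lat \<delta> \<times> lat \<delta>)"
      by (simp add: sets_pair_countable[OF countable_lat countable_lat] cong: sets_pair_measure_cong
          add: sets_pair_measure_cong[OF sets_lat_measure_count sets_lat_measure_count])
    then show ?thesis
      by (auto simp: measurable_def space_pair_measure sets_lat_measure intro: diff_in_lat)
  qed
  have 1: "(\<lambda>p. (snd (fst p), snd (snd p))) \<in> spacetime_measure \<delta> \<Otimes>\<^sub>M spacetime_measure \<delta> \<rightarrow>\<^sub>M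
     (lat_measure \<delta> \<Otimes>\<^sub>M lat_measure \<delta> :: ((real^'d) \<times> (real^'d)) measure)"
    unfolding spacetime_measure_def by measurable
  have 2: "(\<lambda>p. fst (fst p) - fst (snd p)) \<in> spacetime_measure \<delta> \<Otimes>\<^sub>M (spacetime_measure \<delta> :: (real \<times> (real^'d)) measure) \<rightarrow>\<^sub>M borel"
    unfolding spacetime_measure_def by measurable
  have "(\<lambda>p. (fst (fst p) - fst (snd p), snd (fst p) - snd (snd p))) \<in> spacetime_measure \<delta> \<Otimes>\<^sub>M spacetime_measure \<delta> \<rightarrow>\<^sub>M
     (spacetime_measure \<delta> :: (real \<times> (real^'d)) measure)"
    using measurable_compose[OF 1 lat] 2 unfolding spacetime_measure_def[of \<delta>]
    by (intro measurable_Pair) (auto simp: case_prod_beta)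
  then show ?thesis
    by (simp add: case_prod_beta minus_prod_def)
qed

lemma measurable_diff_spacetime [measurable (raw)]:
  assumes "f \<in> N \<rightarrow>\<^sub>M spacetime_measure \<delta>" "g \<in> N \<rightarrow>\<^sub>M spacetime_measure \<delta>"
  shows "(\<lambda>x. f x - g x) \<in> N \<rightarrow>\<^sub>M (spacetime_measure \<delta> :: (real \<times> (real^'d)) measure)"
  using measurable_compose[OF measurable_Pair[OF assms] measurable_minus_spacetime] by simp

text \<open>Bridge from the ambient space: every Borel function there, such as the norm or the Green
  function, is measurable for \<open>spacetime_measure \<delta>\<close>.\<close>

lemma measurable_ident_spacetime: "(\<lambda>x. x) \<in> (spacetime_measure \<delta> :: (real \<times> (real^'d)) measure) \<rightarrow>\<^sub>M borel"
  unfolding borel_prod[symmetric] spacetime_measure_def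
proof -
  have "(\<lambda>x. x) \<in> lat_measure \<delta> \<rightarrow>\<^sub>M (borel :: (real^'d) measure)"
    by (auto simp: measurable_def sets_lat_measure)
  from measurable_compose[OF measurable_snd this]
  have "(\<lambda>p. (fst p, snd p)) \<in> lborel \<Otimes>\<^sub>M lat_measure \<delta> \<rightarrow>\<^sub>M borel \<Otimes>\<^sub>M (borel :: (real^'d) measure)"
    by (intro measurable_Pair) auto
  then show "(\<lambda>x. x) \<in> lborel \<Otimes>\<^sub>M lat_measure \<delta> \<rightarrow>\<^sub>M borel \<Otimes>\<^sub>M (borel :: (real^'d) measure)" by simp
qed

lemma measurable_norm_spacetime [measurable]:
  "norm \<in> borel_measurable (spacetime_measure \<delta> :: (real \<times> (real^'d)) measure)"
  using measurable_compose[OF measurable_ident_spacetime borel_measurable_continuous_onI[OF continuous_on_norm_id]]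
  .

section \<open>The algebra \<open>M_b\<close>\<close>

lemma weight_pos: "0 < (1 + (norm x)\<^sup>2) ^ N"
  by (rule zero_less_power) (simp add: add_pos_nonneg)

lemma M_b_measurable: "g \<in> M_b \<delta> \<Longrightarrow> g \<in> borel_measurable (spacetime_measure \<delta>)"
  by (simp add: M_b_def)

text \<open>Raises the weight exponents of two functions to a common value.\<close>

lemma integrable_weight_mono:
  fixes g :: "real \<times> (real^'d) \<Rightarrow> real"
  assumes "integrable (spacetime_measure \<delta>) (\<lambda>x. g x / (1 + (norm x)\<^sup>2) ^ N)" "N \<le> N'"
  shows "integrable (spacetime_measure \<delta>) (\<lambda>x. g x / (1 + (norm x)\<^sup>2) ^ N')"
proof (rule Bochner_Integration.integrable_bound)
  have "(\<lambda>x. g x / (1 + (norm x)\<^sup>2) ^ N) \<in> borel_measurable (spacetime_measure \<delta>)"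
    using assms(1) by simp
  from borel_measurable_divide[OF this, of "\<lambda>x. (1 + (norm x)\<^sup>2) ^ (N' - N)"]
  have "(\<lambda>x. g x / (1 + (norm x)\<^sup>2) ^ N / (1 + (norm x)\<^sup>2) ^ (N' - N)) \<in> borel_measurable (spacetime_measure \<delta>)"
    by simp
  then show "(\<lambda>x. g x / (1 + (norm x)\<^sup>2) ^ N') \<in> borel_measurable (spacetime_measure \<delta>)"
    using assms(2) by (simp add: divide_divide_eq_left flip: power_add)
  show "AE x in spacetime_measure \<delta>. norm (g x / (1 + (norm x)\<^sup>2) ^ N') \<le> norm (g x / (1 + (norm x)\<^sup>2) ^ N)"
    using assms(2)
    by (intro AE_I2) (auto simp: abs_divide power_increasing intro!: divide_left_mono mult_pos_pos weight_pos)
qed (fact assms(1))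

text \<open>Here it matters that \<open>M_b\<close> controls all exponents: by AM-GM, |gh|^k is at
  most |g|^(2k) + |h|^(2k), so exponent k for the product is paid for by exponent 2k for the
  factors.\<close>

lemma M_b_mult:
  assumes "g \<in> M_b \<delta>" "h \<in> M_b \<delta>"
  shows "(\<lambda>x. g x * h x) \<in> M_b \<delta>"
  unfolding M_b_def
proof (intro CollectI conjI allI)
  note [measurable] = assms[THEN M_b_measurable]
  show "(\<lambda>x. g x * h x) \<in> borel_measurable (spacetime_measure \<delta>)" by measurable
  fix k :: nat
  obtain N1 N2 where N1: "integrable (spacetime_measure \<delta>) (\<lambda>x. \<bar>g x\<bar> ^ (2 * k) / (1 + (norm x)\<^sup>2) ^ N1)"
    and N2: "integrable (spacetime_measure \<delta>) (\<lambda>x. \<bar>h x\<bar> ^ (2 * k) / (1 + (norm x)\<^sup>2) ^ N2)"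
    using assms unfolding M_b_def by blast
  let ?N = "max N1 N2"
  have "integrable (spacetime_measure \<delta>) (\<lambda>x. \<bar>g x * h x\<bar> ^ k / (1 + (norm x)\<^sup>2) ^ ?N)"
  proof (rule Bochner_Integration.integrable_bound)
    show "integrable (spacetime_measure \<delta>)
      (\<lambda>x. \<bar>g x\<bar> ^ (2 * k) / (1 + (norm x)\<^sup>2) ^ ?N + \<bar>h x\<bar> ^ (2 * k) / (1 + (norm x)\<^sup>2) ^ ?N)"
      by (intro Bochner_Integration.integrable_add integrable_weight_mono[OF N1] integrable_weight_mono[OF N2]) auto
    have "\<bar>g x * h x\<bar> ^ k \<le> \<bar>g x\<bar> ^ (2 * k) + \<bar>h x\<bar> ^ (2 * k)" for x
    proof -
      have "0 \<le> (\<bar>g x\<bar> ^ k - \<bar>h x\<bar> ^ k)\<^sup>2" by simp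
      then have "2 * (\<bar>g x\<bar> ^ k * \<bar>h x\<bar> ^ k) \<le> (\<bar>g x\<bar> ^ k)\<^sup>2 + (\<bar>h x\<bar> ^ k)\<^sup>2"
        by (simp add: power2_diff)
      moreover have "0 \<le> \<bar>g x\<bar> ^ k * \<bar>h x\<bar> ^ k" by simp
      ultimately have "\<bar>g x\<bar> ^ k * \<bar>h x\<bar> ^ k \<le> (\<bar>g x\<bar> ^ k)\<^sup>2 + (\<bar>h x\<bar> ^ k)\<^sup>2" by linarith
      then show ?thesis
        by (simp add: abs_mult power_mult_distrib power_mult[symmetric] mult.commute)
    qed
    then show "AE x in spacetime_measure \<delta>. norm (\<bar>g x * h x\<bar> ^ k / (1 + (norm x)\<^sup>2) ^ ?N)
       \<le> norm (\<bar>g x\<bar> ^ (2 * k) / (1 + (norm x)\<^sup>2) ^ ?N + \<bar>h x\<bar> ^ (2 * k) / (1 + (norm x)\<^sup>2) ^ ?N)"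
      by (intro AE_I2) (auto simp flip: add_divide_distrib intro!: divide_right_mono less_imp_le[OF weight_pos])
  qed measurable
  then show "\<exists>N. integrable (spacetime_measure \<delta>) (\<lambda>x. \<bar>g x * h x\<bar> ^ k / (1 + (norm x)\<^sup>2) ^ N)" ..
qed

lemma M_b_add:
  assumes "g \<in> M_b \<delta>" "h \<in> M_b \<delta>"
  shows "(\<lambda>x. g x + h x) \<in> M_b \<delta>"
  unfolding M_b_def
proof (intro CollectI conjI allI)
  note [measurable] = assms[THEN M_b_measurable]
  show "(\<lambda>x. g x + h x) \<in> borel_measurable (spacetime_measure \<delta>)" by measurable
  fix k :: nat
  obtain N1 N2 where N1: "integrable (spacetime_measure \<delta>) (\<lambda>x. \<bar>g x\<bar> ^ k / (1 + (norm x)\<^sup>2) ^ N1)"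
    and N2: "integrable (spacetime_measure \<delta>) (\<lambda>x. \<bar>h x\<bar> ^ k / (1 + (norm x)\<^sup>2) ^ N2)"
    using assms unfolding M_b_def by blast
  let ?N = "max N1 N2"
  have "integrable (spacetime_measure \<delta>) (\<lambda>x. \<bar>g x + h x\<bar> ^ k / (1 + (norm x)\<^sup>2) ^ ?N)"
  proof (rule Bochner_Integration.integrable_bound)
    show "integrable (spacetime_measure \<delta>)
      (\<lambda>x. 2 ^ k * (\<bar>g x\<bar> ^ k / (1 + (norm x)\<^sup>2) ^ ?N + \<bar>h x\<bar> ^ k / (1 + (norm x)\<^sup>2) ^ ?N))"
      by (intro integrable_mult_right Bochner_Integration.integrable_add integrable_weight_mono[OF N1] integrable_weight_mono[OF N2]) auto
    have le: "\<bar>g x + h x\<bar> ^ k \<le> 2 ^ k * (\<bar>g x\<bar> ^ k + \<bar>h x\<bar> ^ k)" for x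
    proof -
      have "\<bar>g x + h x\<bar> \<le> 2 * max \<bar>g x\<bar> \<bar>h x\<bar>" by linarith
      then have "\<bar>g x + h x\<bar> ^ k \<le> (2 * max \<bar>g x\<bar> \<bar>h x\<bar>) ^ k" by (rule power_mono) simp
      also have "\<dots> = 2 ^ k * max \<bar>g x\<bar> \<bar>h x\<bar> ^ k" by (simp add: power_mult_distrib)
      also have "max \<bar>g x\<bar> \<bar>h x\<bar> ^ k \<le> \<bar>g x\<bar> ^ k + \<bar>h x\<bar> ^ k" by (simp add: max_def)
      finally show ?thesis by simp
    qed
    have "\<bar>g x + h x\<bar> ^ k / (1 + (norm x)\<^sup>2) ^ ?N
       \<le> 2 ^ k * (\<bar>g x\<bar> ^ k / (1 + (norm x)\<^sup>2) ^ ?N + \<bar>h x\<bar> ^ k / (1 + (norm x)\<^sup>2) ^ ?N)" for x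
      using divide_right_mono[OF le[of x] less_imp_le[OF weight_pos[of x ?N]]]
      by (simp only: add_divide_distrib[symmetric] times_divide_eq_right)
    then show "AE x in spacetime_measure \<delta>. norm (\<bar>g x + h x\<bar> ^ k / (1 + (norm x)\<^sup>2) ^ ?N)
       \<le> norm (2 ^ k * (\<bar>g x\<bar> ^ k / (1 + (norm x)\<^sup>2) ^ ?N + \<bar>h x\<bar> ^ k / (1 + (norm x)\<^sup>2) ^ ?N))"
      by (intro AE_I2) (simp only: real_norm_def abs_divide abs_power2 power_abs[symmetric] abs_idempotent order_trans[OF _ abs_ge_self]
         abs_of_nonneg[OF less_imp_le[OF weight_pos]])
  qed measurable
  then show "\<exists>N. integrable (spacetime_measure \<delta>) (\<lambda>x. \<bar>g x + h x\<bar> ^ k / (1 + (norm x)\<^sup>2) ^ N)" ..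
qed

lemma M_b_abs: "g \<in> M_b \<delta> \<Longrightarrow> (\<lambda>x. \<bar>g x\<bar>) \<in> M_b \<delta>"
  by (auto simp: M_b_def)

text \<open>Only the exponent \<open>k = 0\<close> of \<open>W \<in> M_b\<close> matters here: it says that some power of the weight
  \<open>1 / (1 + |x|\<^sup>2)\<close> is integrable.\<close>

lemma M_b_poly_bound:
  fixes g W :: "real \<times> (real^'d) \<Rightarrow> real"
  assumes W: "W \<in> M_b \<delta>" and meas: "g \<in> borel_measurable (spacetime_measure \<delta>)"
    and bound: "\<And>x. x \<in> spacetime \<delta> \<Longrightarrow> \<bar>g x\<bar> \<le> C * (1 + (norm x)\<^sup>2) ^ N"
  shows "g \<in> M_b \<delta>"
  unfolding M_b_def
proof (intro CollectI conjI allI)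
  note [measurable] = meas
  show "g \<in> borel_measurable (spacetime_measure \<delta>)" by fact
  fix k :: nat
  have "\<exists>N0. integrable (spacetime_measure \<delta>) (\<lambda>x. \<bar>W x\<bar> ^ 0 / (1 + (norm x)\<^sup>2) ^ N0)"
    using W unfolding M_b_def by blast
  then obtain N0 where N0: "integrable (spacetime_measure \<delta>) (\<lambda>x::real \<times> (real^'d). 1 / (1 + (norm x)\<^sup>2) ^ N0)"
    by auto
  have "integrable (spacetime_measure \<delta>) (\<lambda>x. \<bar>g x\<bar> ^ k / (1 + (norm x)\<^sup>2) ^ (N0 + N * k))"
  proof (rule Bochner_Integration.integrable_bound)
    show "integrable (spacetime_measure \<delta>) (\<lambda>x::real \<times> (real^'d). C ^ k * (1 / (1 + (norm x)\<^sup>2) ^ N0))"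
      by (intro integrable_mult_right N0)
    have "\<bar>g x\<bar> ^ k / (1 + (norm x)\<^sup>2) ^ (N0 + N * k) \<le> C ^ k * (1 / (1 + (norm x)\<^sup>2) ^ N0)"
      if "x \<in> spacetime \<delta>" for x
    proof -
      have "\<bar>g x\<bar> ^ k \<le> (C * (1 + (norm x)\<^sup>2) ^ N) ^ k"
        by (intro power_mono bound that) auto
      also have "\<dots> = C ^ k * (1 + (norm x)\<^sup>2) ^ (N * k)" by (simp add: power_mult_distrib power_mult)
      finally show ?thesis
        using weight_pos[of x N0] weight_pos[of x "N * k"] weight_pos[of x 1]
        by (auto simp: power_add field_simps)
    qed
    then show "AE x in spacetime_measure \<delta>. norm (\<bar>g x\<bar> ^ k / (1 + (norm x)\<^sup>2) ^ (N0 + N * k))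
      \<le> norm (C ^ k * (1 / (1 + (norm x)\<^sup>2) ^ N0))"
      by (intro AE_I2) (simp add: order_trans[OF _ divide_right_mono[OF abs_ge_self less_imp_le[OF weight_pos]]])
  qed measurable
  then show "\<exists>N. integrable (spacetime_measure \<delta>) (\<lambda>x. \<bar>g x\<bar> ^ k / (1 + (norm x)\<^sup>2) ^ N)" ..
qed

lemma M_b_const: "W \<in> M_b \<delta> \<Longrightarrow> (\<lambda>_::real \<times> (real^'d). c) \<in> M_b \<delta>"
  for W :: "real \<times> (real^'d) \<Rightarrow> real"
  by (rule M_b_poly_bound[where C = "\<bar>c\<bar>" and N = 0 and W = W]) auto

lemma M_b_power: "g \<in> M_b \<delta> \<Longrightarrow> (\<lambda>x. g x ^ n) \<in> M_b \<delta>"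
  by (induction n) (auto intro: M_b_mult M_b_const)

text \<open>\<open>W\<close> is the witness through which \<open>M_b_const\<close> puts constants
  into \<open>M_b\<close>; the value 0 of an empty sum is such a constant.\<close>

lemma M_b_sum:
  fixes W :: "real \<times> (real^'d) \<Rightarrow> real" and g :: "'i \<Rightarrow> real \<times> (real^'d) \<Rightarrow> real"
  assumes "W \<in> M_b \<delta>" and "\<And>i. i \<in> I \<Longrightarrow> g i \<in> M_b \<delta>"
  shows "(\<lambda>x. \<Sum>i\<in>I. g i x) \<in> M_b \<delta>"
  using assms
  by (induction I rule: infinite_finite_induct) (auto intro: M_b_add M_b_const[of W])

lemma M_b_prod:
  fixes W :: "real \<times> (real^'d) \<Rightarrow> real" and g :: "'i \<Rightarrow> real \<times> (real^'d) \<Rightarrow> real"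
  assumes "W \<in> M_b \<delta>" and "\<And>i. i \<in> I \<Longrightarrow> g i \<in> M_b \<delta>"
  shows "(\<lambda>x. \<Prod>i\<in>I. g i x) \<in> M_b \<delta>"
  using assms
  by (induction I rule: infinite_finite_induct) (auto intro: M_b_mult M_b_const[of W])

lemma M_b_prod_list:
  fixes W :: "real \<times> (real^'d) \<Rightarrow> real" and g :: "'i \<Rightarrow> real \<times> (real^'d) \<Rightarrow> real"
  assumes "W \<in> M_b \<delta>" and "\<And>i. i \<in> set xs \<Longrightarrow> g i \<in> M_b \<delta>"
  shows "(\<lambda>x. prod_list (map (\<lambda>i. g i x) xs)) \<in> M_b \<delta>"
  using assms
  by (induction xs) (auto intro: M_b_mult M_b_const[of W])

section \<open>Convolution with rapidly decreasing kernels\<close>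

text \<open>The weight exponent of a function in \<open>M_b\<close> is not known in advance, so the
  kernel has to decay faster than every power. Abstracting from \<open>green\<close> lets the
  results apply to its absolute value as well.\<close>

definition rapid_kernel :: "real \<Rightarrow> (real \<times> (real^'d) \<Rightarrow> real) \<Rightarrow> bool" where
  "rapid_kernel \<delta> G \<longleftrightarrow> G \<in> borel_measurable (spacetime_measure \<delta>) \<and>
     (\<forall>N::nat. \<exists>C. \<forall>x\<in>spacetime \<delta>. \<bar>G x\<bar> \<le> C / (1 + (norm x)\<^sup>2) ^ N)"

lemma rapid_kernel_abs: "rapid_kernel \<delta> G \<Longrightarrow> rapid_kernel \<delta> (\<lambda>x. \<bar>G x\<bar>)"
  by (auto simp: rapid_kernel_def)

text \<open>Peetre's inequality. It trades the weight at y for the weight at x - y, which a kernel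
  absorbs, and the weight at x, which survives as polynomial growth of a convolution.\<close>

lemma peetre:
  fixes x y :: "'a::real_normed_vector"
  shows "1 + (norm y)\<^sup>2 \<le> 2 * (1 + (norm (x - y))\<^sup>2) * (1 + (norm x)\<^sup>2)"
proof -
  have "norm y \<le> norm (x - y) + norm x"
    using norm_triangle_ineq[of "y - x" x] by (simp add: norm_minus_commute)
  then have "(norm y)\<^sup>2 \<le> (norm (x - y) + norm x)\<^sup>2" by (rule power_mono) simp
  also have "\<dots> \<le> 2 * (norm (x - y))\<^sup>2 + 2 * (norm x)\<^sup>2"
    using sum_squares_bound[of "norm (x - y)" "norm x"] by (simp add: power2_sum)
  finally have "1 + (norm y)\<^sup>2 \<le> 2 + 2 * (norm (x - y))\<^sup>2 + 2 * (norm x)\<^sup>2" by simp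
  also have "\<dots> \<le> 2 * (1 + (norm (x - y))\<^sup>2) * (1 + (norm x)\<^sup>2)"
    by (simp add: algebra_simps)
  finally show ?thesis .
qed

text \<open>The exponent N is taken from the case k = 1 of g in \<open>M_b\<close>, and the decay of
  the kernel is used with the same N. Peetre's inequality then bounds the integrand by (1 + |x|^2)^N
  times an integrable function of y, so the convolution is polynomially bounded at every
  point.\<close>

lemma
  assumes G: "rapid_kernel \<delta> G" and g: "g \<in> M_b \<delta>"
  shows integrable_conv: "x \<in> spacetime \<delta> \<Longrightarrow> integrable (spacetime_measure \<delta>) (\<lambda>y. G (x - y) * g y)"
    and M_b_conv: "conv \<delta> G g \<in> M_b \<delta>"
proof -
  note [measurable] = M_b_measurable[OF g]
  have G_meas[measurable]: "G \<in> borel_measurable (spacetime_measure \<delta>)" using G by (simp add: rapid_kernel_def)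
  have "\<exists>N. integrable (spacetime_measure \<delta>) (\<lambda>x. \<bar>g x\<bar> ^ 1 / (1 + (norm x)\<^sup>2) ^ N)"
    using g unfolding M_b_def by blast
  then obtain N where N: "integrable (spacetime_measure \<delta>) (\<lambda>x. \<bar>g x\<bar> / (1 + (norm x)\<^sup>2) ^ N)" by auto
  obtain C where C: "\<And>x. x \<in> spacetime \<delta> \<Longrightarrow> \<bar>G x\<bar> \<le> C / (1 + (norm x)\<^sup>2) ^ N"
    using G unfolding rapid_kernel_def by blast
  have C0: "0 \<le> C"
    using C[of 0] by (auto simp: spacetime_def zero_in_lat zero_prod_def)
  have bound: "\<bar>G (x - y) * g y\<bar> \<le> C * 2 ^ N * (1 + (norm x)\<^sup>2) ^ N * (\<bar>g y\<bar> / (1 + (norm y)\<^sup>2) ^ N)"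
    if "x \<in> spacetime \<delta>" "y \<in> spacetime \<delta>" for x y
  proof -
    have "(1 + (norm y)\<^sup>2) ^ N \<le> (2 * (1 + (norm (x - y))\<^sup>2) * (1 + (norm x)\<^sup>2)) ^ N"
      by (intro power_mono peetre) simp
    then have "C * (1 + (norm y)\<^sup>2) ^ N \<le> C * (2 ^ N * (1 + (norm (x - y))\<^sup>2) ^ N * (1 + (norm x)\<^sup>2) ^ N)"
      using C0 by (intro mult_left_mono) (simp_all only: power_mult_distrib)
    then have "C / (1 + (norm (x - y))\<^sup>2) ^ N \<le> C * 2 ^ N * (1 + (norm x)\<^sup>2) ^ N / (1 + (norm y)\<^sup>2) ^ N"
      using weight_pos[of y N] weight_pos[of "x - y" N] by (simp add: field_simps)
    with C[OF diff_in_spacetime[OF that]]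
    have "\<bar>G (x - y)\<bar> \<le> C * 2 ^ N * (1 + (norm x)\<^sup>2) ^ N / (1 + (norm y)\<^sup>2) ^ N" by linarith
    then have "\<bar>G (x - y)\<bar> * \<bar>g y\<bar> \<le> C * 2 ^ N * (1 + (norm x)\<^sup>2) ^ N / (1 + (norm y)\<^sup>2) ^ N * \<bar>g y\<bar>"
      by (rule mult_right_mono) simp
    then show ?thesis by (simp add: abs_mult)
  qed
  show int: "integrable (spacetime_measure \<delta>) (\<lambda>y. G (x - y) * g y)" if x: "x \<in> spacetime \<delta>" for x
  proof (rule Bochner_Integration.integrable_bound)
    show "integrable (spacetime_measure \<delta>) (\<lambda>y. C * 2 ^ N * (1 + (norm x)\<^sup>2) ^ N * (\<bar>g y\<bar> / (1 + (norm y)\<^sup>2) ^ N))"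
      by (intro integrable_mult_right N)
    have [measurable]: "(\<lambda>_. x) \<in> spacetime_measure \<delta> \<rightarrow>\<^sub>M spacetime_measure \<delta>"
      using x by simp
    show "(\<lambda>y. G (x - y) * g y) \<in> borel_measurable (spacetime_measure \<delta>)" by measurable
    show "AE y in spacetime_measure \<delta>. norm (G (x - y) * g y) \<le>
      norm (C * 2 ^ N * (1 + (norm x)\<^sup>2) ^ N * (\<bar>g y\<bar> / (1 + (norm y)\<^sup>2) ^ N))"
      using bound[OF x] by (intro AE_I2) (simp only: space_spacetime_measure real_norm_def order_trans[OF _ abs_ge_self])
  qed
  define I where "I = (\<integral>y. \<bar>g y\<bar> / (1 + (norm y)\<^sup>2) ^ N \<partial>spacetime_measure \<delta>)"
  have "\<bar>conv \<delta> G g x\<bar> \<le> C * 2 ^ N * I * (1 + (norm x)\<^sup>2) ^ N" if x: "x \<in> spacetime \<delta>" for x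
  proof -
    have "\<bar>conv \<delta> G g x\<bar> \<le> (\<integral>y. norm (G (x - y) * g y) \<partial>spacetime_measure \<delta>)"
      unfolding conv_def using integral_norm_bound[of "spacetime_measure \<delta>" "\<lambda>y. G (x - y) * g y"] by simp
    also have "\<dots> \<le> (\<integral>y. C * 2 ^ N * (1 + (norm x)\<^sup>2) ^ N * (\<bar>g y\<bar> / (1 + (norm y)\<^sup>2) ^ N) \<partial>spacetime_measure \<delta>)"
      using bound[OF x] by (intro integral_mono integrable_norm int x integrable_mult_right N) auto
    also have "\<dots> = C * 2 ^ N * (1 + (norm x)\<^sup>2) ^ N * I"
      unfolding I_def by (rule integral_mult_right_zero)
    finally show ?thesis by (simp add: mult_ac)
  qed
  moreover have "conv \<delta> G g \<in> borel_measurable (spacetime_measure \<delta>)"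
    unfolding conv_def[abs_def] by measurable
  ultimately show "conv \<delta> G g \<in> M_b \<delta>"
    by (intro M_b_poly_bound[OF g])
qed

section \<open>Decay of the Green function\<close>

text \<open>The integrals over the cube are the coefficients of a power series in the time variable
  (up to normalization, they count lattice walks with \<open>n\<close> steps ending at \<open>x\<close>).\<close>

definition walk_integral :: "real \<Rightarrow> nat \<Rightarrow> real^'d \<Rightarrow> complex" where
  "walk_integral \<delta> n x = (LINT p : cbox 0 (\<chi> i. 2 * pi / \<delta>) | lborel.
     exp (- \<i> * of_real (p \<bullet> x)) * of_real ((\<Sum>i\<in>UNIV. 2 * cos (\<delta> * p $ i)) ^ n))"

section \<open>Orthogonality of characters on the cube\<close>

lemma integral_cube_prod:
  fixes g :: "'d::finite \<Rightarrow> real \<Rightarrow> complex" and c :: real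
  assumes "\<And>i. continuous_on UNIV (g i)"
  shows "(LINT p : cbox (0 :: real^'d) (\<chi> i. c) | lborel. (\<Prod>i\<in>UNIV. g i (p $ i)))
    = (\<Prod>i\<in>UNIV. LINT s : {0..c} | lborel. g i s)"
proof -
  interpret product_sigma_finite "\<lambda>_ :: real^'d. lborel :: real measure" ..
  have axis_inj: "inj (\<lambda>i. axis i (1::real) :: real^'d)"
    by (auto simp: inj_on_def axis_eq_axis)
  have Basis: "(Basis :: (real^'d) set) = range (\<lambda>i. axis i 1)"
    by (auto simp: Basis_vec_def)
  \<comment> \<open>Lebesgue measure on \<open>real^'d\<close> is a product over
    \<open>Basis\<close>, while the factors are indexed by coordinates; \<open>h\<close> transports
    them along the bijection from i to \<open>axis i 1\<close>.\<close>
  define h where "h b = g (inv (\<lambda>i. axis i (1::real) :: real^'d) b)" for b :: "real^'d"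
  have h: "h (axis i 1) = g i" for i by (simp add: h_def inv_f_f[OF axis_inj])
  have hc: "continuous_on UNIV (h b)" for b unfolding h_def by (rule assms)
  then have [measurable]: "h b \<in> borel_measurable borel" for b by (rule borel_measurable_continuous_onI)
  have prod_Basis: "(\<Prod>b\<in>Basis. k b) = (\<Prod>i\<in>UNIV. k (axis i 1))" for k :: "real^'d \<Rightarrow> complex"
    unfolding Basis by (subst prod.reindex[OF axis_inj]) simp
  have int: "integrable lborel (\<lambda>s. indicator {0..c} s *\<^sub>R h b s)" for b
    using continuous_on_subset[OF hc subset_UNIV] by (intro borel_integrable_compact) auto
  have F: "indicator (cbox 0 (\<chi> i. c)) p *\<^sub>R (\<Prod>i\<in>UNIV. g i (p $ i)) =
      (\<Prod>b\<in>Basis. indicator {0..c} (p \<bullet> b) *\<^sub>R h b (p \<bullet> b))" for p :: "real^'d"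
  proof -
    have "(\<Prod>b\<in>Basis. indicator {0..c} (p \<bullet> b) *\<^sub>R h b (p \<bullet> b)) = (\<Prod>i\<in>UNIV. indicator {0..c} (p $ i) *\<^sub>R g i (p $ i))"
      unfolding prod_Basis by (simp add: h inner_axis)
    also have "\<dots> = of_real (\<Prod>i\<in>UNIV. indicator {0..c} (p $ i)) * (\<Prod>i\<in>UNIV. g i (p $ i))"
      by (simp add: scaleR_conv_of_real prod.distrib)
    also have "(\<Prod>i\<in>UNIV. indicator {0..c} (p $ i)) = (indicator (cbox 0 (\<chi> i. c)) p :: real)"
    proof (cases "p \<in> cbox 0 (\<chi> i. c)")
      case True
      then show ?thesis by (auto simp: mem_box_cart intro!: prod.neutral)
    next
      case False
      then obtain i where "p $ i \<notin> {0..c}" by (auto simp: mem_box_cart)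
      then have "indicator {0..c} (p $ i) = (0 :: real)" by (simp add: indicator_def)
      then show ?thesis using False by (subst prod_zero) auto
    qed
    finally show ?thesis by (simp add: scaleR_conv_of_real)
  qed
  have "(LINT p : cbox (0 :: real^'d) (\<chi> i. c) | lborel. (\<Prod>i\<in>UNIV. g i (p $ i)))
      = (\<integral>p. (\<Prod>b\<in>Basis. indicator {0..c} (p \<bullet> b) *\<^sub>R h b (p \<bullet> b)) \<partial>(lborel :: (real^'d) measure))"
    unfolding set_lebesgue_integral_def F ..
  also have "\<dots> = (\<integral>f. (\<Prod>b\<in>Basis. indicator {0..c} (f b) *\<^sub>R h b (f b)) \<partial>(\<Pi>\<^sub>M b\<in>(Basis :: (real^'d) set). lborel))"
    by (subst lborel_eq, subst integral_distr) simp_all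
  also have "\<dots> = (\<Prod>b\<in>Basis. \<integral>s. indicator {0..c} s *\<^sub>R h b s \<partial>lborel)"
    by (rule product_integral_prod) (simp_all add: int)
  also have "\<dots> = (\<Prod>i\<in>UNIV. LINT s : {0..c} | lborel. g i s)"
    unfolding prod_Basis by (simp add: h set_lebesgue_integral_def)
  finally show ?thesis .
qed

lemma integral_exp_period:
  fixes \<delta> :: real and k :: int
  assumes "\<delta> > 0" "k \<noteq> 0"
  shows "(LINT s : {0..2 * pi / \<delta>} | lborel. exp (- \<i> * of_real (s * (\<delta> * of_int k)))) = 0"
proof -
  define c where "c = - \<i> * of_real (\<delta> * of_int k)"
  have c0: "c \<noteq> 0" using assms by (simp add: c_def)
  have "((\<lambda>s. exp (c * of_real s) / c) has_vector_derivative exp (c * of_real s)) (at s within A)" for s A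
    using c0 by (auto intro!: derivative_eq_intros has_vector_derivative_real_field)
  then have "(LINT s : {0..2 * pi / \<delta>} | lborel. exp (c * of_real s)) = exp (c * of_real (2 * pi / \<delta>)) / c - exp (c * of_real 0) / c"
    using assms unfolding set_lebesgue_integral_def
    by (intro integral_FTC_atLeastAtMost continuous_intros) auto
  \<comment> \<open>Over a full period the exponent changes by an integer multiple of 2 pi i, so the
    antiderivative takes the same value at both ends.\<close>
  also have "c * of_real (2 * pi / \<delta>) = 2 * of_int (- k) * of_real pi * \<i>"
    using assms by (simp add: c_def)
  also have "exp \<dots> = 1"
    unfolding exp_eq_1 by (auto intro!: exI[of _ "- k"])
  finally show ?thesis by (simp add: c_def mult_ac)
qed

text \<open>A walk without steps ends at 0. The integral factors over the coordinates, and at a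
  coordinate where x is nonzero the factor is a nontrivial character integrated over a full
  period.\<close>

lemma walk_integral_0:
  assumes \<delta>: "\<delta> > 0" and x: "x \<in> lat \<delta>" "x \<noteq> 0"
  shows "walk_integral \<delta> 0 x = 0"
proof -
  obtain j where j: "x $ j \<noteq> 0" using x(2) by (auto simp: vec_eq_iff)
  obtain k :: int where k: "x $ j = \<delta> * of_int k" using x(1) unfolding lat_def by auto
  have k0: "k \<noteq> 0" using j k by auto
  have "walk_integral \<delta> 0 x = (LINT p : cbox 0 (\<chi> i. 2 * pi / \<delta>) | lborel. (\<Prod>i\<in>UNIV. exp (- \<i> * of_real (p $ i * x $ i))))"
    unfolding walk_integral_def
    by (simp add: inner_vec_def sum_distrib_left flip: exp_sum sum_negf)
  also have "\<dots> = (\<Prod>i\<in>UNIV. LINT s : {0..2 * pi / \<delta>} | lborel. exp (- \<i> * of_real (s * x $ i)))"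
    by (rule integral_cube_prod) (intro continuous_intros)
  also have "\<dots> = 0"
    using integral_exp_period[OF \<delta> k0] by (intro prod_zero) (auto intro!: exI[of _ j] simp: k)
  finally show ?thesis .
qed

section \<open>Recursion and bound for the walk integrals\<close>

lemma set_integrable_cube:
  fixes F :: "real^'d \<Rightarrow> complex"
  assumes "continuous_on UNIV F"
  shows "set_integrable lborel (cbox 0 (\<chi> i. c)) F"
  unfolding set_integrable_def
  using continuous_on_subset[OF assms] by (intro borel_integrable_compact compact_cbox) auto

lemma walk_integrand_continuous:
  fixes x :: "real^'d"
  shows "continuous_on UNIV (\<lambda>p. exp (- \<i> * of_real (p \<bullet> x)) * of_real ((\<Sum>i\<in>UNIV. 2 * cos (\<delta> * p $ i)) ^ n))"
  by (intro continuous_intros)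

text \<open>The last step of a walk: 2 cos (\<delta> p_j) is a sum of two exponentials, and
  multiplication by them shifts x by \<delta> in the two directions of axis j.\<close>

lemma walk_integral_Suc:
  fixes x :: "real^'d"
  shows "walk_integral \<delta> (Suc n) x = (\<Sum>j\<in>UNIV. walk_integral \<delta> n (x - axis j \<delta>) + walk_integral \<delta> n (x + axis j \<delta>))"
proof -
  let ?e = "\<lambda>x p. exp (- \<i> * of_real (p \<bullet> x)) * of_real ((\<Sum>i\<in>UNIV. 2 * cos (\<delta> * p $ i)) ^ n)"
  have *: "exp (- \<i> * of_real (p \<bullet> x)) * of_real (2 * cos (\<delta> * p $ j)) =
     exp (- \<i> * of_real (p \<bullet> (x - axis j \<delta>))) + exp (- \<i> * of_real (p \<bullet> (x + axis j \<delta>)))" for p :: "real^'d" and j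
  proof -
    have "of_real (2 * cos (\<delta> * p $ j)) = exp (\<i> * of_real (\<delta> * p $ j)) + exp (- (\<i> * of_real (\<delta> * p $ j)))"
      by (simp add: cos_of_real[symmetric] cos_exp_eq del: cos_of_real)
    then show ?thesis
      by (simp add: inner_diff_right inner_add_right inner_axis distrib_left right_diff_distrib exp_add[symmetric] mult_ac)
  qed
  have "walk_integral \<delta> (Suc n) x = (LINT p : cbox 0 (\<chi> i. 2 * pi / \<delta>) | lborel. \<Sum>j\<in>UNIV. ?e (x - axis j \<delta>) p + ?e (x + axis j \<delta>) p)"
    unfolding walk_integral_def
  proof (intro set_lebesgue_integral_cong allI impI)
    fix p :: "real^'d"
    have "exp (- \<i> * of_real (p \<bullet> x)) * of_real ((\<Sum>i\<in>UNIV. 2 * cos (\<delta> * p $ i)) ^ Suc n)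
      = (\<Sum>j\<in>UNIV. (exp (- \<i> * of_real (p \<bullet> x)) * of_real (2 * cos (\<delta> * p $ j))) * of_real ((\<Sum>i\<in>UNIV. 2 * cos (\<delta> * p $ i)) ^ n))"
      by (simp add: sum_distrib_left sum_distrib_right mult_ac del: cos_of_real)
    then show "exp (- \<i> * of_real (p \<bullet> x)) * of_real ((\<Sum>i\<in>UNIV. 2 * cos (\<delta> * p $ i)) ^ Suc n)
      = (\<Sum>j\<in>UNIV. ?e (x - axis j \<delta>) p + ?e (x + axis j \<delta>) p)"
      unfolding * distrib_right .
  qed simp
  also have "\<dots> = (\<Sum>j\<in>UNIV. LINT p : cbox 0 (\<chi> i. 2 * pi / \<delta>) | lborel. ?e (x - axis j \<delta>) p + ?e (x + axis j \<delta>) p)"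
    using set_integrable_cube[unfolded set_integrable_def, OF continuous_on_add[OF walk_integrand_continuous walk_integrand_continuous]]
    unfolding set_lebesgue_integral_def scaleR_sum_right
    by (intro Bochner_Integration.integral_sum) auto
  also have "\<dots> = (\<Sum>j\<in>UNIV. walk_integral \<delta> n (x - axis j \<delta>) + walk_integral \<delta> n (x + axis j \<delta>))"
    unfolding walk_integral_def
    by (intro sum.cong refl set_integral_add set_integrable_cube walk_integrand_continuous)
  finally show ?thesis .
qed

lemma axis_in_lat: "axis j \<delta> \<in> lat \<delta>"
  unfolding lat_def by (auto simp: axis_def intro: exI[of _ 1] exI[of _ 0])

text \<open>The l1 norm suits the walk because one step changes it by at most \<delta>. The volume
  of the cube is the integral for no steps at the origin, and 2d counts the neighbours of a point.
  The rate \<open>a\<close> is left free; it is fixed in \<open>heat_kernel_bound\<close>.\<close>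

lemma walk_integral_bound:
  assumes \<delta>: "\<delta> > 0" and a: "a \<ge> 0" and x: "x \<in> lat \<delta>"
  shows "norm (walk_integral \<delta> n (x :: real^'d)) \<le>
    measure lborel (cbox (0 :: real^'d) (\<chi> i. 2 * pi / \<delta>)) * (2 * CARD('d) * exp a) ^ n * exp (- a / \<delta> * (\<Sum>i\<in>UNIV. \<bar>x $ i\<bar>))"
  using x
proof (induction n arbitrary: x)
  case 0
  show ?case
  proof (cases "x = 0")
    case True
    then show ?thesis
      by (simp add: walk_integral_def set_lebesgue_integral_def scaleR_conv_of_real)
  next
    case False
    then show ?thesis using walk_integral_0[OF \<delta> 0] by simp
  qed
next
  case (Suc n)
  let ?V = "measure lborel (cbox (0 :: real^'d) (\<chi> i. 2 * pi / \<delta>))"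
  let ?l = "\<lambda>x :: real^'d. \<Sum>i\<in>UNIV. \<bar>x $ i\<bar>"
  have step: "norm (walk_integral \<delta> n y) \<le> ?V * (2 * CARD('d) * exp a) ^ n * (exp a * exp (- a / \<delta> * ?l x))"
    if "y \<in> lat \<delta>" "?l x - \<delta> \<le> ?l y" for y
  proof -
    have "- a / \<delta> * ?l y \<le> - a / \<delta> * (?l x - \<delta>)"
      using that(2) a \<delta> by (intro mult_left_mono_neg) auto
    also have "\<dots> = a + - a / \<delta> * ?l x" using \<delta> by (simp add: field_simps)
    finally have "exp (- a / \<delta> * ?l y) \<le> exp a * exp (- a / \<delta> * ?l x)"
      by (simp add: exp_add[symmetric])
    then show ?thesis
      by (intro order_trans[OF Suc.IH[OF that(1)]] mult_left_mono) auto
  qed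
  have l: "?l x - \<delta> \<le> ?l (x - axis j \<delta>)" "?l x - \<delta> \<le> ?l (x + axis j \<delta>)" for j
  proof -
    have "?l x \<le> ?l (x - axis j \<delta>) + ?l (axis j \<delta>)" "?l x \<le> ?l (x + axis j \<delta>) + ?l (axis j \<delta>)"
      by (auto simp flip: sum.distrib intro!: sum_mono)
    moreover have "?l (axis j \<delta>) = \<delta>"
      using \<delta> by (simp add: axis_def if_distrib[of abs] cong: if_cong)
    ultimately show "?l x - \<delta> \<le> ?l (x - axis j \<delta>)" "?l x - \<delta> \<le> ?l (x + axis j \<delta>)" by auto
  qed
  have "norm (walk_integral \<delta> (Suc n) x) \<le>
    (\<Sum>j\<in>(UNIV::'d set). 2 * (?V * (2 * CARD('d) * exp a) ^ n * (exp a * exp (- a / \<delta> * ?l x))))"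
    unfolding walk_integral_Suc
  proof (intro sum_norm_le)
    fix j
    show "norm (walk_integral \<delta> n (x - axis j \<delta>) + walk_integral \<delta> n (x + axis j \<delta>)) \<le>
      2 * (?V * (2 * CARD('d) * exp a) ^ n * (exp a * exp (- a / \<delta> * ?l x)))"
      using step[OF diff_in_lat[OF Suc.prems axis_in_lat] l(1)[of j]]
        step[OF add_in_lat[OF Suc.prems axis_in_lat] l(2)[of j]]
      by (intro norm_triangle_le) linarith
  qed
  also have "\<dots> = ?V * (2 * CARD('d) * exp a) ^ Suc n * exp (- a / \<delta> * ?l x)"
    by (simp only: sum_constant power_Suc of_nat_mult of_nat_numeral mult_ac)
  finally show ?case .
qed

section \<open>Exponential decay of the heat kernel\<close>

text \<open>Sum and integral may be exchanged because the cosine sum is at most 2d in absolute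
  value: on the cube, which has finite volume, the n-th term is dominated by the n-th term of an
  exponential series.\<close>

lemma heat_kernel_series:
  fixes x :: "real^'d"
  assumes "\<delta> > 0"
  shows "(\<lambda>n. of_real ((t / \<delta>\<^sup>2) ^ n / fact n) * walk_integral \<delta> n x) sums
    (LINT p : cbox 0 (\<chi> i. 2 * pi / \<delta>) | lborel.
      exp (- \<i> * of_real (p \<bullet> x)) * of_real (exp (t / \<delta>\<^sup>2 * (\<Sum>i\<in>UNIV. 2 * cos (\<delta> * p $ i)))))"
proof -
  let ?Q = "cbox (0 :: real^'d) (\<chi> i. 2 * pi / \<delta>)"
  let ?S = "\<lambda>p :: real^'d. \<Sum>i\<in>UNIV. 2 * cos (\<delta> * p $ i)"
  define \<tau> where "\<tau> = t / \<delta>\<^sup>2"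
  define F where "F n p = indicator ?Q p *\<^sub>R (of_real (\<tau> ^ n / fact n) * (exp (- \<i> * of_real (p \<bullet> x)) * of_real (?S p ^ n)))" for n p
  define B where "B n = (\<bar>\<tau>\<bar> * (2 * CARD('d))) ^ n / fact n" for n
  have B_summable: "summable B"
    unfolding B_def using summable_exp[of "\<bar>\<tau>\<bar> * (2 * CARD('d))"] by (simp add: field_simps)
  have S_bound: "\<bar>?S p\<bar> \<le> 2 * CARD('d)" for p
  proof -
    have "\<bar>?S p\<bar> \<le> (\<Sum>i\<in>(UNIV::'d set). 2)"
      by (intro order_trans[OF sum_abs] sum_mono) (auto simp: abs_mult)
    then show ?thesis by simp
  qed
  have F_bound: "norm (F n p) \<le> indicator ?Q p * B n" for n p
  proof -
    have "\<bar>\<tau>\<bar> ^ n / fact n * \<bar>?S p\<bar> ^ n \<le> B n"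
      unfolding B_def power_mult_distrib using power_mono[OF S_bound[of p], of n]
      by (simp add: divide_right_mono mult_left_mono)
    then show ?thesis
      unfolding F_def norm_scaleR norm_mult norm_of_real
      by (auto simp: abs_mult power_abs split: split_indicator)
  qed
  have F_int: "integrable lborel (F n)" for n
    unfolding F_def
    by (rule set_integrable_cube[unfolded set_integrable_def]) (intro continuous_intros walk_integrand_continuous)
  have "integrable lborel (indicat_real ?Q)"
    by (rule integrable_real_indicator[OF _ emeasure_lborel_cbox_finite]) simp
  from integrable_mult_left[OF this]
  have ind: "integrable lborel (\<lambda>p. indicator ?Q p * B n)" for n .
  have "(\<lambda>n. integral\<^sup>L lborel (F n)) sums (\<integral>p. (\<Sum>n. F n p) \<partial>lborel)"
  proof (rule sums_integral[where M = lborel and f = F])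
    show "AE p in lborel. summable (\<lambda>n. norm (F n p))"
    proof (intro AE_I2)
      fix p
      show "summable (\<lambda>n. norm (F n p))"
        by (rule summable_comparison_test'[where g = "\<lambda>n. indicator ?Q p * B n" and N = 0])
           (use F_bound summable_mult[OF B_summable] in auto)
    qed
    have "(\<integral>p. norm (F n p) \<partial>lborel) \<le> measure lborel ?Q * B n" for n
    proof -
      have "(\<integral>p. norm (F n p) \<partial>lborel) \<le> (\<integral>p. indicator ?Q p * B n \<partial>lborel)"
        by (intro integral_mono integrable_norm F_int ind F_bound)
      also have "\<dots> = measure lborel ?Q * B n" by simp
      finally show ?thesis .
    qed
    then show "summable (\<lambda>n. \<integral>p. norm (F n p) \<partial>lborel)"
      by (intro summable_comparison_test'[OF summable_mult[OF B_summable], where N = 0]) auto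
  qed (fact F_int)
  moreover have "integral\<^sup>L lborel (F n) = of_real (\<tau> ^ n / fact n) * walk_integral \<delta> n x" for n
    unfolding F_def walk_integral_def set_lebesgue_integral_def
    by (simp only: mult_scaleR_right[symmetric] integral_mult_right_zero)
  moreover have "(\<Sum>n. F n p) = indicator ?Q p *\<^sub>R (exp (- \<i> * of_real (p \<bullet> x)) * of_real (exp (\<tau> * ?S p)))" for p
  proof -
    have "(\<lambda>n. (\<tau> * ?S p) ^ n /\<^sub>R fact n) sums exp (\<tau> * ?S p)" by (rule exp_converges)
    from sums_of_real[OF this, where 'a = complex]
    have "(\<lambda>n. indicator ?Q p *\<^sub>R (exp (- \<i> * of_real (p \<bullet> x)) * of_real ((\<tau> * ?S p) ^ n /\<^sub>R fact n))) sums
      (indicator ?Q p *\<^sub>R (exp (- \<i> * of_real (p \<bullet> x)) * of_real (exp (\<tau> * ?S p))))"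
      by (intro sums_scaleR_right sums_mult)
    moreover have "indicator ?Q p *\<^sub>R (exp (- \<i> * of_real (p \<bullet> x)) * of_real ((\<tau> * ?S p) ^ n /\<^sub>R fact n)) = F n p" for n
      by (simp add: F_def power_mult_distrib divide_inverse mult_ac)
    ultimately show ?thesis by (simp add: sums_iff)
  qed
  ultimately show ?thesis unfolding \<tau>_def set_lebesgue_integral_def by simp
qed

lemma heat_kernel_bound:
  assumes \<delta>: "\<delta> > 0" and m0: "m0 > 0"
  shows "\<exists>C k. k > 0 \<and> (\<forall>t\<ge>0. \<forall>x\<in>lat \<delta>. \<bar>heat_kernel \<delta> m0 t (x :: real^'d)\<bar> \<le> C * exp (- k * norm (t, x)))"
proof -
  let ?d = "real CARD('d)"
  \<comment> \<open>Chosen so that 2d e^a / \<delta>^2 = 2d / \<delta>^2 + m0^2 / 2: the spatial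
    weight costs half of the mass term, and the other half remains as decay in time.\<close>
  define a where "a = ln (1 + m0\<^sup>2 * \<delta>\<^sup>2 / (4 * ?d))"
  have pos: "m0\<^sup>2 * \<delta>\<^sup>2 / (4 * ?d) > 0" using \<delta> m0 by simp
  then have a0: "a > 0" and ea: "exp a = 1 + m0\<^sup>2 * \<delta>\<^sup>2 / (4 * ?d)"
    by (auto simp: a_def add_pos_pos)
  define V where "V = measure lborel (cbox (0 :: real^'d) (\<chi> i. 2 * pi / \<delta>))"
  define C where "C = V / (2 * pi) ^ CARD('d)"
  have C0: "C \<ge> 0" by (simp add: C_def V_def)
  \<comment> \<open>The slower of the two rates, m0^2 / 2 in time and a / \<delta> in space.\<close>
  define k where "k = min (m0\<^sup>2 / 2) (a / \<delta>)"
  have k0: "k > 0" using \<delta> m0 a0 by (simp add: k_def)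
  have "\<bar>heat_kernel \<delta> m0 t x\<bar> \<le> C * exp (- k * norm (t, x))" if t: "t \<ge> 0" and x: "x \<in> lat \<delta>" for t and x :: "real^'d"
  proof -
    define I where "I = (LINT p : cbox 0 (\<chi> i. 2 * pi / \<delta>) | lborel.
      exp (- \<i> * of_real (p \<bullet> x)) * of_real (exp (t / \<delta>\<^sup>2 * (\<Sum>i\<in>UNIV. 2 * cos (\<delta> * p $ i)))))"
    define E where "E = exp (- t * (2 * ?d / \<delta>\<^sup>2 + m0\<^sup>2))"
    define L where "L = exp (- a / \<delta> * (\<Sum>i\<in>UNIV. \<bar>x $ i\<bar>))"
    have sums: "(\<lambda>n. of_real ((t / \<delta>\<^sup>2) ^ n / fact n) * walk_integral \<delta> n x) sums I"
      unfolding I_def by (rule heat_kernel_series[OF \<delta>])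
    have Bsums: "(\<lambda>n. V * L * ((t / \<delta>\<^sup>2 * (2 * ?d * exp a)) ^ n /\<^sub>R fact n)) sums (V * L * exp (t / \<delta>\<^sup>2 * (2 * ?d * exp a)))"
      by (intro sums_mult exp_converges)
    have "norm I \<le> V * L * exp (t / \<delta>\<^sup>2 * (2 * ?d * exp a))"
    proof -
      have le: "norm (of_real ((t / \<delta>\<^sup>2) ^ n / fact n) * walk_integral \<delta> n x) \<le> V * L * ((t / \<delta>\<^sup>2 * (2 * ?d * exp a)) ^ n /\<^sub>R fact n)" for n
      proof -
        have "norm (of_real ((t / \<delta>\<^sup>2) ^ n / fact n) * walk_integral \<delta> n x) \<le> (t / \<delta>\<^sup>2) ^ n / fact n * (V * (2 * ?d * exp a) ^ n * L)"
        proof -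
          have "\<bar>(t / \<delta>\<^sup>2) ^ n / fact n\<bar> = (t / \<delta>\<^sup>2) ^ n / fact n" using t by simp
          moreover have "norm (walk_integral \<delta> n x) \<le> V * (2 * ?d * exp a) ^ n * L"
            using walk_integral_bound[OF \<delta> less_imp_le[OF a0] x, of n] by (simp add: V_def L_def)
          ultimately show ?thesis
            unfolding norm_mult norm_of_real using t by (simp only:) (intro mult_left_mono, simp_all)
        qed
        then show ?thesis by (simp add: power_mult_distrib divide_inverse mult_ac)
      qed
      have "norm (suminf (\<lambda>n. of_real ((t / \<delta>\<^sup>2) ^ n / fact n) * walk_integral \<delta> n x)) \<le> suminf (\<lambda>n. V * L * ((t / \<delta>\<^sup>2 * (2 * ?d * exp a)) ^ n /\<^sub>R fact n))"
        by (intro norm_suminf_le le sums_summable[OF Bsums])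
      then show ?thesis using sums Bsums by (simp add: sums_iff)
    qed
    also have "t / \<delta>\<^sup>2 * (2 * ?d * exp a) = t * (2 * ?d / \<delta>\<^sup>2 + m0\<^sup>2) - t * (m0\<^sup>2 / 2)"
      unfolding ea using \<delta> by (simp add: field_simps)
    finally have I_bound: "norm I \<le> V * L * exp (t * (2 * ?d / \<delta>\<^sup>2 + m0\<^sup>2) - t * (m0\<^sup>2 / 2))" .
    \<comment> \<open>\<open>E\<close> collects what does not depend on p; the remaining exponential
      of the cosine sum is the one expanded in \<open>heat_kernel_series\<close>.\<close>
    have mu: "exp (- t * mu_sq \<delta> m0 p) = E * exp (t / \<delta>\<^sup>2 * (\<Sum>i\<in>UNIV. 2 * cos (\<delta> * p $ i)))" for p :: "real^'d"
    proof -
      define c where "c = (\<Sum>i\<in>UNIV. cos (\<delta> * p $ i))"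
      have "- t * (2 / \<delta>\<^sup>2 * (?d - c) + m0\<^sup>2) = - t * (2 * ?d / \<delta>\<^sup>2 + m0\<^sup>2) + t / \<delta>\<^sup>2 * (2 * c)"
        using \<delta> by (simp add: field_simps)
      then show ?thesis
        by (simp only: E_def mu_sq_def sum_distrib_left[symmetric] c_def exp_add)
    qed
    have "heat_kernel \<delta> m0 t x = Re (of_real E * I / (2 * of_real pi) ^ CARD('d))"
      unfolding heat_kernel_def mu I_def of_real_mult mult.left_commute[of _ "of_real E"]
      by (simp only: set_integral_mult_right)
    then have "\<bar>heat_kernel \<delta> m0 t x\<bar> \<le> norm (of_real E * I / (2 * of_real pi) ^ CARD('d))"
      by (simp only: abs_Re_le_cmod)
    also have "\<dots> = E * norm I / (2 * pi) ^ CARD('d)"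
      by (simp add: norm_mult norm_divide norm_power E_def)
    also have "\<dots> \<le> E * (V * L * exp (t * (2 * ?d / \<delta>\<^sup>2 + m0\<^sup>2) - t * (m0\<^sup>2 / 2))) / (2 * pi) ^ CARD('d)"
      by (intro divide_right_mono mult_left_mono I_bound) (auto simp: E_def)
    also have "\<dots> = C * (L * exp (- t * (m0\<^sup>2 / 2)))"
    proof -
      have "E * exp (t * (2 * ?d / \<delta>\<^sup>2 + m0\<^sup>2) - t * (m0\<^sup>2 / 2)) = exp (- t * (m0\<^sup>2 / 2))"
        unfolding E_def exp_add[symmetric] by simp
      then show ?thesis by (simp add: C_def mult_ac)
    qed
    also have "L * exp (- t * (m0\<^sup>2 / 2)) \<le> exp (- k * norm (t, x))"
    proof -
      have "k * norm (t, x) \<le> k * (\<bar>t\<bar> + (\<Sum>i\<in>UNIV. \<bar>x $ i\<bar>))"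
        using k0 norm_Pair_le[of t x] norm_le_l1_cart[of x] by (intro mult_left_mono) auto
      also have "\<dots> \<le> (m0\<^sup>2 / 2) * \<bar>t\<bar> + a / \<delta> * (\<Sum>i\<in>UNIV. \<bar>x $ i\<bar>)"
        unfolding distrib_left k_def by (intro add_mono mult_right_mono min.cobounded1 min.cobounded2 sum_nonneg) auto
      finally show ?thesis using t by (simp add: L_def mult_ac flip: exp_add)
    qed
    finally show ?thesis using C0 by (simp add: mult_left_mono)
  qed
  then show ?thesis using k0 by blast
qed

text \<open>Rests on (1 + s/n)^n \<le> e^s with s = k r.\<close>

lemma exp_decay_rapid:
  fixes k :: real
  assumes k: "k > 0"
  shows "\<exists>C. \<forall>r\<ge>0. exp (- k * r) \<le> C / (1 + r\<^sup>2) ^ N"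
proof -
  \<comment> \<open>The factor 2 comes from 1 + r^2 \<le> (1 + r)^2; \<open>Suc N\<close> keeps n
    positive even when N = 0.\<close>
  define n where "n = 2 * Suc N"
  \<comment> \<open>The bound c \<ge> n / k gives r \<le> c (k r / n), and c \<ge> 1 takes care of
    the summand 1.\<close>
  define c where "c = max 1 (n / k)"
  have c: "c \<ge> 1" "c * k \<ge> n" using k by (auto simp: c_def field_simps max_def)
  have "exp (- k * r) \<le> c ^ n / (1 + r\<^sup>2) ^ N" if r: "r \<ge> 0" for r
  proof -
    have n: "n > 0" by (simp add: n_def)
    have "r * n \<le> r * (c * k)" using c r by (intro mult_left_mono) auto
    then have "r \<le> c * (k * r / n)" using n by (simp add: field_simps)
    then have "1 + r \<le> c * (1 + k * r / n)" using c by (simp add: distrib_left)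
    then have "(1 + r) ^ n \<le> c ^ n * (1 + k * r / n) ^ n"
      using r by (simp add: power_mono flip: power_mult_distrib)
    also have "\<dots> \<le> c ^ n * exp (k * r)"
      using c k r n by (intro mult_left_mono exp_ge_one_plus_x_over_n_power_n) (auto intro: order_trans[of _ 0])
    finally have 1: "(1 + r) ^ n \<le> c ^ n * exp (k * r)" .
    have "(1 + r\<^sup>2) ^ N \<le> (1 + r\<^sup>2) ^ Suc N" by (intro power_increasing) auto
    also have "\<dots> \<le> ((1 + r)\<^sup>2) ^ Suc N" using r by (intro power_mono) (auto simp: power2_sum)
    also have "\<dots> = (1 + r) ^ n" unfolding n_def by (rule power_mult[symmetric])
    finally have "(1 + r\<^sup>2) ^ N \<le> c ^ n * exp (k * r)" using 1 by linarith
    then show ?thesis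
      using weight_pos[of r N] by (simp add: exp_minus field_simps)
  qed
  then show ?thesis by blast
qed

lemma green_rapid_kernel:
  assumes \<delta>: "\<delta> > 0" and m0: "m0 > 0"
  shows "rapid_kernel \<delta> (green \<delta> m0 :: real \<times> (real^'d) \<Rightarrow> real)"
  unfolding rapid_kernel_def
proof (intro conjI allI)
  have [measurable]: "(\<lambda>p :: real^'d. p $ i) \<in> borel_measurable borel" for i
    by (intro borel_measurable_continuous_onI continuous_intros)
  have "(\<lambda>(t, x). heat_kernel \<delta> m0 t x) \<in> borel_measurable (borel \<Otimes>\<^sub>M (borel :: (real^'d) measure))"
    unfolding heat_kernel_def set_lebesgue_integral_def mu_sq_def by measurable
  then have "green \<delta> m0 \<in> borel_measurable (borel \<Otimes>\<^sub>M (borel :: (real^'d) measure))"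
    unfolding green_def case_prod_beta' by measurable
  then have "green \<delta> m0 \<in> borel_measurable (borel :: (real \<times> (real^'d)) measure)"
    unfolding borel_prod .
  from measurable_compose[OF measurable_ident_spacetime this]
  show "green \<delta> m0 \<in> borel_measurable (spacetime_measure \<delta> :: (real \<times> (real^'d)) measure)" .
  fix N
  obtain C k where k: "k > 0" and C: "\<forall>t\<ge>0. \<forall>x\<in>lat \<delta>. \<bar>heat_kernel \<delta> m0 t (x :: real^'d)\<bar> \<le> C * exp (- k * norm (t, x))"
    using heat_kernel_bound[OF assms] by (elim exE conjE)
  obtain D where D: "\<And>r. r \<ge> 0 \<Longrightarrow> exp (- k * r) \<le> D / (1 + r\<^sup>2) ^ N"
    using exp_decay_rapid[OF k, of N] by blast
  \<comment> \<open>Evaluated at the origin, the two bounds show that C and D are nonnegative; the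
    case t \<le> 0, where \<open>green\<close> is 0, relies on it.\<close>
  have "0 \<le> \<bar>heat_kernel \<delta> m0 0 (0 :: real^'d)\<bar>" by simp
  also have "\<dots> \<le> C * exp (- k * norm (0 :: real, 0 :: real^'d))" using C zero_in_lat by blast
  also have "\<dots> = C" by (simp flip: zero_prod_def)
  finally have C0: "0 \<le> C" .
  have D0: "0 \<le> D" using D[of 0] by simp
  have "\<bar>green \<delta> m0 x\<bar> \<le> C * D / (1 + (norm x)\<^sup>2) ^ N" if "x \<in> spacetime \<delta>" for x :: "real \<times> (real^'d)"
  proof (cases "fst x > 0")
    case True
    then have "\<bar>green \<delta> m0 x\<bar> \<le> C * exp (- k * norm x)"
      using C[rule_format, of "fst x" "snd x"] that by (auto simp: green_def case_prod_beta spacetime_def)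
    also have "\<dots> \<le> C * (D / (1 + (norm x)\<^sup>2) ^ N)" by (intro mult_left_mono D C0) auto
    finally show ?thesis by simp
  next
    case False
    then show ?thesis
      using C0 D0 by (auto simp: green_def case_prod_beta intro!: divide_nonneg_nonneg)
  qed
  then show "\<exists>C. \<forall>x\<in>spacetime \<delta>. \<bar>green \<delta> m0 x\<bar> \<le> C / (1 + (norm (x :: real \<times> (real^'d)))\<^sup>2) ^ N" by blast
qed

section \<open>Tree integrals\<close>

text \<open>The possible first steps of a path in \<open>Inner Ts\<close>. They flatten the nested
  lists into one finite index set for inductions, products and disjoint unions.\<close>

definition children :: "rtree list list \<Rightarrow> (nat \<times> nat) set" where
  "children Ts = (SIGMA i:{..<length Ts}. {..<length (Ts ! i)})"

definition child :: "rtree list list \<Rightarrow> nat \<times> nat \<Rightarrow> rtree" where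
  "child Ts c = Ts ! fst c ! snd c"

lemma finite_children [simp]: "finite (children Ts)"
  by (simp add: children_def)

lemma rtree_child_induct [case_names Leaf Inner]:
  assumes "\<And>a. P (Leaf a)" and "\<And>Ts. (\<And>c. c \<in> children Ts \<Longrightarrow> P (child Ts c)) \<Longrightarrow> P (Inner Ts)"
  shows "P T"
proof (induction T)
  case (Inner Ts)
  show ?case
    by (intro assms(2) Inner[of "Ts ! fst c" "child Ts c" for c]) (auto simp: children_def child_def)
qed (rule assms(1))

lemma prod_list_children:
  fixes h :: "rtree \<Rightarrow> real"
  shows "prod_list (map (\<lambda>ts. prod_list (map h ts)) Ts) = (\<Prod>c\<in>children Ts. h (child Ts c))"
  unfolding children_def child_def
  by (simp add: prod.list_conv_set_nth prod.Sigma lessThan_atLeast0 case_prod_beta)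

lemma subtree_at_Cons:
  "subtree_at (Inner Ts) (c # u) = (if c \<in> children Ts then subtree_at (child Ts c) u else None)"
  by (cases c) (auto simp: children_def child_def)

lemma inner_vertices_Leaf [simp]: "inner_vertices (Leaf a) = {}"
  by (auto simp: inner_vertices_def elim: subtree_at.elims)

lemma inner_vertices_Inner:
  "inner_vertices (Inner Ts) = insert [] (\<Union>c\<in>children Ts. (#) c ` inner_vertices (child Ts c))"
proof (intro set_eqI)
  fix u
  show "u \<in> inner_vertices (Inner Ts) \<longleftrightarrow> u \<in> insert [] (\<Union>c\<in>children Ts. (#) c ` inner_vertices (child Ts c))"
    by (cases u) (auto simp: inner_vertices_def subtree_at_Cons simp del: subtree_at.simps(3) split: if_splits)
qed

lemma leaves_Leaf [simp]: "leaves a (Leaf b) = (if a = b then {[]} else {})"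
  by (auto simp: leaves_def elim: subtree_at.elims)

lemma leaves_Inner: "leaves a (Inner Ts) = (\<Union>c\<in>children Ts. (#) c ` leaves a (child Ts c))"
proof (intro set_eqI)
  fix u
  show "u \<in> leaves a (Inner Ts) \<longleftrightarrow> u \<in> (\<Union>c\<in>children Ts. (#) c ` leaves a (child Ts c))"
    by (cases u) (auto simp: leaves_def subtree_at_Cons simp del: subtree_at.simps(3) split: if_splits)
qed

lemma finite_inner_vertices [simp]: "finite (inner_vertices T)"
  by (induction T rule: rtree_child_induct) (auto simp: inner_vertices_Inner)

lemma finite_leaves [simp]: "finite (leaves a T)"
  by (induction T rule: rtree_child_induct) (auto simp: leaves_Inner)

lemma leaves_inner_disjoint: "inner_vertices T \<inter> leaves a T = {}"
  by (auto simp: inner_vertices_def leaves_def)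

text \<open>Every edge starts at the root or at an inner vertex, so the position of a parent is x or
  one of the integration variables.\<close>

lemma butlast_inner:
  "u \<in> inner_vertices T \<or> u \<in> leaves a T \<Longrightarrow> u \<noteq> [] \<Longrightarrow> butlast u \<in> inner_vertices T"
proof (induction T arbitrary: u rule: rtree_child_induct)
  case (Leaf b)
  then show ?case by (auto split: if_splits)
next
  case (Inner Ts)
  then obtain c v where c: "c \<in> children Ts" "u = c # v" "v \<in> inner_vertices (child Ts c) \<or> v \<in> leaves a (child Ts c)"
    by (auto simp: inner_vertices_Inner leaves_Inner)
  then show ?case
    using Inner.IH[OF c(1,3)] by (auto simp: inner_vertices_Inner)
qed

lemma prod_UN_Cons:
  fixes h :: "_ \<Rightarrow> real"
  assumes "finite C" "\<And>c. c \<in> C \<Longrightarrow> finite (S c)"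
  shows "(\<Prod>u\<in>(\<Union>c\<in>C. (#) c ` S c). h u) = (\<Prod>c\<in>C. \<Prod>u\<in>S c. h (c # u))"
proof -
  have "(\<Prod>u\<in>(\<Union>c\<in>C. (#) c ` S c). h u) = (\<Prod>c\<in>C. \<Prod>u\<in>(#) c ` S c. h u)"
    using assms by (intro prod.UNION_disjoint) auto
  also have "\<dots> = (\<Prod>c\<in>C. \<Prod>u\<in>S c. h (c # u))"
    by (rule prod.cong[OF refl]) (simp add: prod.reindex)
  finally show ?thesis .
qed

subsection \<open>Integrating over the inner vertices\<close>

text \<open>The subtree entered by the path \<open>q\<close> of a larger tree is integrated over the variables
  \<open>y (q @ u)\<close>; carrying \<open>q\<close> along makes the variables of disjoint subtrees disjoint
  without renaming. The factor \<open>\<phi> a\<close> stands for an integrated leaf of type \<open>a\<close>.\<close>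

definition parent_at :: "vertex \<Rightarrow> 'a \<Rightarrow> (vertex \<Rightarrow> 'a) \<Rightarrow> vertex \<Rightarrow> 'a" where
  "parent_at q x y u = (if u = [] then x else y (q @ butlast u))"

definition inner_integrand ::
  "('a::minus \<Rightarrow> real) \<Rightarrow> (leaf_type \<Rightarrow> 'a \<Rightarrow> real) \<Rightarrow> rtree \<Rightarrow> vertex \<Rightarrow> 'a \<Rightarrow> (vertex \<Rightarrow> 'a) \<Rightarrow> real" where
  "inner_integrand G \<phi> T q x y =
     (\<Prod>u\<in>inner_vertices T. G (parent_at q x y u - y (q @ u))) *
     (\<Prod>u\<in>leaves Type_One T. \<phi> Type_One (parent_at q x y u)) *
     (\<Prod>u\<in>leaves Type_Two T. \<phi> Type_Two (parent_at q x y u))"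

lemma inner_integrand_Leaf: "inner_integrand G \<phi> (Leaf a) q x y = \<phi> a x"
  by (cases a) (auto simp: inner_integrand_def parent_at_def)

lemma inner_integrand_Inner:
  "inner_integrand G \<phi> (Inner Ts) q x y =
     G (x - y q) * (\<Prod>c\<in>children Ts. inner_integrand G \<phi> (child Ts c) (q @ [c]) (y q) y)"
proof -
  have par: "parent_at q x y (c # u) = parent_at (q @ [c]) (y q) y u" for c u
    by (simp add: parent_at_def)
  have inner: "(\<Prod>u\<in>inner_vertices (Inner Ts). G (parent_at q x y u - y (q @ u))) =
      G (x - y q) * (\<Prod>c\<in>children Ts. \<Prod>u\<in>inner_vertices (child Ts c). G (parent_at (q @ [c]) (y q) y u - y ((q @ [c]) @ u)))"
    unfolding inner_vertices_Inner
    by (subst prod.insert) (auto simp: prod_UN_Cons par, simp add: parent_at_def)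
  show ?thesis
    unfolding inner_integrand_def inner leaves_Inner
    by (simp add: prod_UN_Cons par prod.distrib mult_ac)
qed

text \<open>The integrand reads only the variables of its own subtree. This locality lets the trees
  attached to one vertex be integrated independently.\<close>

lemma inner_integrand_cong:
  "(\<And>u. u \<in> inner_vertices T \<Longrightarrow> y (q @ u) = y' (q @ u)) \<Longrightarrow>
   inner_integrand G \<phi> T q x y = inner_integrand G \<phi> T q x y'"
proof (induction T arbitrary: q x rule: rtree_child_induct)
  case (Inner Ts)
  have q: "y q = y' q" using Inner.prems[of "[]"] by (simp add: inner_vertices_Inner)
  have "inner_integrand G \<phi> (child Ts c) (q @ [c]) (y' q) y = inner_integrand G \<phi> (child Ts c) (q @ [c]) (y' q) y'"
    if "c \<in> children Ts" for c
    using that Inner.prems[of "c # u" for u] by (intro Inner.IH) (auto simp: inner_vertices_Inner)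
  then show ?case by (simp add: inner_integrand_Inner q)
qed (simp add: inner_integrand_Leaf)

text \<open>Makes absolute convergence an instance of the evaluation for nonnegative data.\<close>

lemma inner_integrand_abs:
  "inner_integrand (\<lambda>x. \<bar>G x\<bar>) (\<lambda>a x. \<bar>\<phi> a x\<bar>) T q x y = \<bar>inner_integrand G \<phi> T q x y\<bar>"
  by (simp add: inner_integrand_def abs_mult abs_prod)

lemma measurable_inner_integrand:
  fixes G :: "real \<times> (real^'d) \<Rightarrow> real"
  assumes [measurable]: "G \<in> borel_measurable (spacetime_measure \<delta>)" "\<And>a. \<phi> a \<in> borel_measurable (spacetime_measure \<delta>)"
    and "X \<in> N \<rightarrow>\<^sub>M spacetime_measure \<delta>" and "\<And>u. u \<in> inner_vertices T \<Longrightarrow> (\<lambda>\<omega>. Y \<omega> (q @ u)) \<in> N \<rightarrow>\<^sub>M spacetime_measure \<delta>"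
  shows "(\<lambda>\<omega>. inner_integrand G \<phi> T q (X \<omega>) (Y \<omega>)) \<in> borel_measurable N"
  using assms(3,4)
proof (induction T arbitrary: q X rule: rtree_child_induct)
  case (Leaf a)
  note [measurable] = Leaf.prems(1)
  show ?case unfolding inner_integrand_Leaf by measurable
next
  case (Inner Ts)
  note [measurable] = Inner.prems(1)
  have [measurable]: "(\<lambda>\<omega>. Y \<omega> q) \<in> N \<rightarrow>\<^sub>M spacetime_measure \<delta>"
    using Inner.prems(2)[of "[]"] by (simp add: inner_vertices_Inner)
  have [measurable]: "(\<lambda>\<omega>. inner_integrand G \<phi> (child Ts c) (q @ [c]) (Y \<omega> q) (Y \<omega>)) \<in> borel_measurable N"
    if "c \<in> children Ts" for c
    using Inner.prems(2)[of "c # u" for u] that by (intro Inner.IH) (auto simp: inner_vertices_Inner)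
  show ?case unfolding inner_integrand_Inner by measurable
qed

text \<open>Fubini for factors that depend on disjoint blocks of variables, adding one block at a
  time. By the last assumption a factor takes the same value on an assignment of the union and on
  its restriction to the block.\<close>

lemma (in product_sigma_finite)
  fixes F :: "'c \<Rightarrow> ('i \<Rightarrow> 'a) \<Rightarrow> real"
  assumes "finite C" "\<And>c. c \<in> C \<Longrightarrow> finite (K c)" "disjoint_family_on K C"
    and "\<And>c. c \<in> C \<Longrightarrow> integrable (Pi\<^sub>M (K c) M) (F c)"
    and "\<And>c y y'. c \<in> C \<Longrightarrow> (\<And>i. i \<in> K c \<Longrightarrow> y i = y' i) \<Longrightarrow> F c y = F c y'"
  shows integrable_prod_blocks: "integrable (Pi\<^sub>M (\<Union>c\<in>C. K c) M) (\<lambda>y. \<Prod>c\<in>C. F c y)"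
    and integral_prod_blocks: "(\<integral>y. (\<Prod>c\<in>C. F c y) \<partial>Pi\<^sub>M (\<Union>c\<in>C. K c) M) = (\<Prod>c\<in>C. integral\<^sup>L (Pi\<^sub>M (K c) M) (F c))"
proof -
  have "integrable (Pi\<^sub>M (\<Union>c\<in>C. K c) M) (\<lambda>y. \<Prod>c\<in>C. F c y) \<and>
    (\<integral>y. (\<Prod>c\<in>C. F c y) \<partial>Pi\<^sub>M (\<Union>c\<in>C. K c) M) = (\<Prod>c\<in>C. integral\<^sup>L (Pi\<^sub>M (K c) M) (F c))"
    using assms
  proof (induction C rule: finite_induct)
    case empty
    show ?case
      \<comment> \<open>Over no variables the product measure has total mass 1, matching the empty
        product of integrals.\<close>
      using product_integrable_prod[of "{}" "\<lambda>_ _. 1 :: real"] product_integral_prod[of "{}" "\<lambda>_ _. 1 :: real"] by simp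
  next
    case (insert c C)
    let ?I = "K c" and ?J = "\<Union>c\<in>C. K c"
    let ?H = "\<lambda>y. \<Prod>c\<in>C. F c y"
    have fin: "finite ?I" "finite ?J" using insert.prems(1) insert.hyps(1) by auto
    have disj: "?I \<inter> ?J = {}"
      using insert.prems(2) insert.hyps(2) by (auto simp: disjoint_family_on_def)
    interpret I: finite_product_sigma_finite M ?I by standard fact
    interpret J: finite_product_sigma_finite M ?J by standard fact
    interpret P: pair_sigma_finite "Pi\<^sub>M ?I M" "Pi\<^sub>M ?J M" ..
    have F: "integrable (Pi\<^sub>M ?I M) (F c)" using insert.prems(3) by simp
    have IH: "integrable (Pi\<^sub>M ?J M) ?H" "integral\<^sup>L (Pi\<^sub>M ?J M) ?H = (\<Prod>c\<in>C. integral\<^sup>L (Pi\<^sub>M (K c) M) (F c))"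
    proof -
      have "disjoint_family_on K C"
        using insert.prems(2) by (auto simp: disjoint_family_on_def)
      note IH = insert.IH[OF insert.prems(1) this insert.prems(3) insert.prems(4)]
      show "integrable (Pi\<^sub>M ?J M) ?H" by (rule conjunct1[OF IH]) auto
      show "integral\<^sup>L (Pi\<^sub>M ?J M) ?H = (\<Prod>c\<in>C. integral\<^sup>L (Pi\<^sub>M (K c) M) (F c))" by (rule conjunct2[OF IH]) auto
    qed
    have merge: "F c (merge ?I ?J (x, y)) * ?H (merge ?I ?J (x, y)) = F c x * ?H y" for x y
    proof -
      have "F c (merge ?I ?J (x, y)) = F c x"
        using disj by (intro insert.prems(4)) (auto simp: merge_def)
      moreover have "F c' (merge ?I ?J (x, y)) = F c' y" if "c' \<in> C" for c'
        using disj that by (intro insert.prems(4)) (auto simp: merge_def)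
      ultimately show ?thesis by simp
    qed
    note [measurable] = borel_measurable_integrable[OF F] borel_measurable_integrable[OF IH(1)]
    have pair: "integrable (Pi\<^sub>M ?I M \<Otimes>\<^sub>M Pi\<^sub>M ?J M) (\<lambda>(x, y). F c x * ?H y)"
    proof (rule P.Fubini_integrable)
      show "integrable (Pi\<^sub>M ?I M) (\<lambda>x. \<integral>y. norm (case (x, y) of (x, y) \<Rightarrow> F c x * ?H y) \<partial>Pi\<^sub>M ?J M)"
        using F by (simp add: abs_mult)
      show "AE x in Pi\<^sub>M ?I M. integrable (Pi\<^sub>M ?J M) (\<lambda>y. case (x, y) of (x, y) \<Rightarrow> F c x * ?H y)"
        using IH(1) by simp
    qed measurable
    have "integrable (distr (Pi\<^sub>M ?I M \<Otimes>\<^sub>M Pi\<^sub>M ?J M) (Pi\<^sub>M (?I \<union> ?J) M) (merge ?I ?J)) (\<lambda>y. F c y * ?H y)"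
    proof (subst integrable_distr_eq)
      \<comment> \<open>Measurability on the union is inherited from the blocks by restricting
        assignments to them.\<close>
      have r: "(\<lambda>y. restrict y ?I) \<in> Pi\<^sub>M (?I \<union> ?J) M \<rightarrow>\<^sub>M Pi\<^sub>M ?I M" "(\<lambda>y. restrict y ?J) \<in> Pi\<^sub>M (?I \<union> ?J) M \<rightarrow>\<^sub>M Pi\<^sub>M ?J M"
        by (intro measurable_restrict_subset; auto)+
      have "F c (restrict y ?I) * ?H (restrict y ?J) = F c y * ?H y" for y
      proof -
        have "F c (restrict y ?I) = F c y" by (intro insert.prems(4)) auto
        moreover have "F c' (restrict y ?J) = F c' y" if "c' \<in> C" for c'
          using that by (intro insert.prems(4)) auto
        ultimately show ?thesis by simp
      qed
      moreover have "(\<lambda>y. F c (restrict y ?I) * ?H (restrict y ?J)) \<in> borel_measurable (Pi\<^sub>M (?I \<union> ?J) M)"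
        by (intro borel_measurable_times measurable_compose[OF r(1)] measurable_compose[OF r(2)]
            borel_measurable_integrable[OF F] borel_measurable_integrable[OF IH(1)])
      ultimately show "(\<lambda>y. F c y * ?H y) \<in> borel_measurable (Pi\<^sub>M (?I \<union> ?J) M)" by simp
      show "integrable (Pi\<^sub>M ?I M \<Otimes>\<^sub>M Pi\<^sub>M ?J M) (\<lambda>x. F c (merge ?I ?J x) * ?H (merge ?I ?J x))"
        using pair by (simp add: case_prod_beta' merge[of "fst x" "snd x" for x, simplified])
    qed measurable
    then have int: "integrable (Pi\<^sub>M (?I \<union> ?J) M) (\<lambda>y. F c y * ?H y)"
      by (simp add: distr_merge[OF disj fin])
    moreover have "(\<integral>y. F c y * ?H y \<partial>Pi\<^sub>M (?I \<union> ?J) M) = integral\<^sup>L (Pi\<^sub>M ?I M) (F c) * integral\<^sup>L (Pi\<^sub>M ?J M) ?H"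
      by (subst product_integral_fold[OF disj fin int]) (simp add: merge)
    ultimately show ?case
      using insert.hyps by (simp add: IH(2))
  qed
  then show "integrable (Pi\<^sub>M (\<Union>c\<in>C. K c) M) (\<lambda>y. \<Prod>c\<in>C. F c y)"
    "(\<integral>y. (\<Prod>c\<in>C. F c y) \<partial>Pi\<^sub>M (\<Union>c\<in>C. K c) M) = (\<Prod>c\<in>C. integral\<^sup>L (Pi\<^sub>M (K c) M) (F c))"
    by auto
qed

section \<open>Recursive evaluation of tree integrals from the root\<close>

text \<open>The value of a tree without its multiplicity. The nested \<open>map\<close> form exposes
  the recursive calls as list elements; \<open>iterated_value_Inner\<close> turns it into a product
  over \<open>children\<close>.\<close>

fun iterated_value ::
  "real \<Rightarrow> (real \<times> (real^'d) \<Rightarrow> real) \<Rightarrow> (leaf_type \<Rightarrow> real \<times> (real^'d) \<Rightarrow> real) \<Rightarrow> rtree \<Rightarrow> real \<times> (real^'d) \<Rightarrow> real" where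
  "iterated_value \<delta> G \<phi> (Leaf a) = \<phi> a"
| "iterated_value \<delta> G \<phi> (Inner Ts) =
     conv \<delta> G (\<lambda>y. prod_list (map (\<lambda>ts. prod_list (map (\<lambda>T. iterated_value \<delta> G \<phi> T y) ts)) Ts))"

lemma iterated_value_Inner:
  "iterated_value \<delta> G \<phi> (Inner Ts) = conv \<delta> G (\<lambda>y. \<Prod>c\<in>children Ts. iterated_value \<delta> G \<phi> (child Ts c) y)"
  by (simp add: prod_list_children)

lemma iterated_value_M_b:
  assumes "rapid_kernel \<delta> G" "\<And>a. \<phi> a \<in> M_b \<delta>"
  shows "iterated_value \<delta> G \<phi> T \<in> M_b \<delta>"
  by (induction T rule: rtree_child_induct)
    (auto simp: iterated_value_Inner simp del: iterated_value.simps(2) intro!: M_b_conv M_b_prod[OF assms(2)] assms)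

text \<open>The kernel and the leaf functions vary in the induction because its hypothesis is used
  twice: for the absolute values, to bound the integral by Tonelli, and for the given data, to
  compute it.\<close>

lemma inner_integral:
  fixes G :: "real \<times> (real^'d) \<Rightarrow> real"
  assumes "rapid_kernel \<delta> G" "\<And>a. \<phi> a \<in> M_b \<delta>" "x \<in> spacetime \<delta>"
  shows "integrable (\<Pi>\<^sub>M u\<in>(@) q ` inner_vertices T. spacetime_measure \<delta>) (inner_integrand G \<phi> T q x) \<and>
    (\<integral>y. inner_integrand G \<phi> T q x y \<partial>(\<Pi>\<^sub>M u\<in>(@) q ` inner_vertices T. spacetime_measure \<delta>)) = iterated_value \<delta> G \<phi> T x"
  using assms
proof (induction T arbitrary: G \<phi> q x rule: rtree_child_induct)
  case (Leaf a)
  have "integrable (\<Pi>\<^sub>M u\<in>({} :: vertex set). spacetime_measure \<delta> :: (real \<times> (real^'d)) measure) (\<lambda>_. 1 :: real)"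
    "(\<integral>_. 1 \<partial>(\<Pi>\<^sub>M u\<in>({} :: vertex set). spacetime_measure \<delta> :: (real \<times> (real^'d)) measure)) = (1 :: real)"
    using st_prod.product_integrable_prod[of "{}" "\<delta>" "\<lambda>_ _. 1 :: real"]
      st_prod.product_integral_prod[of "{}" "\<delta>" "\<lambda>_ _. 1 :: real"] by simp_all
  then show ?case
    unfolding inner_integrand_Leaf[abs_def]
    using integrable_mult_right[of "\<phi> a x" "\<Pi>\<^sub>M u\<in>({} :: vertex set). spacetime_measure \<delta> :: (real \<times> (real^'d)) measure" "\<lambda>_. 1"]
      integral_mult_right_zero[of "\<Pi>\<^sub>M u\<in>({} :: vertex set). spacetime_measure \<delta> :: (real \<times> (real^'d)) measure" "\<phi> a x" "\<lambda>_. 1"]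
    by simp
next
  case (Inner Ts)
  let ?S = "spacetime_measure \<delta> :: (real \<times> (real^'d)) measure"
  let ?B = "\<lambda>c. (@) (q @ [c]) ` inner_vertices (child Ts c)"
  let ?K = "\<Union>c\<in>children Ts. ?B c"
  have index: "(@) q ` inner_vertices (Inner Ts) = insert q ?K"
    by (force simp: inner_vertices_Inner image_UN image_image)
  have q: "q \<notin> ?K" and finK: "finite ?K" by auto
  \<comment> \<open>Paths into different attached trees differ in the step that follows q.\<close>
  have disj: "disjoint_family_on ?B (children Ts)"
    by (auto simp: disjoint_family_on_def)
  \<comment> \<open>Reassigning the variable at q does not affect the attached trees, whose
    variables sit at longer paths.\<close>
  have upd: "inner_integrand G \<phi> (child Ts c) (q @ [c]) w (y(q := v)) = inner_integrand G \<phi> (child Ts c) (q @ [c]) w y"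
    for G \<phi> c w y and v :: "real \<times> (real^'d)"
    by (rule inner_integrand_cong) auto
  have blocks: "integrable (Pi\<^sub>M ?K (\<lambda>_. ?S)) (\<lambda>y. \<Prod>c\<in>children Ts. inner_integrand G \<phi> (child Ts c) (q @ [c]) w y)"
    "(\<integral>y. (\<Prod>c\<in>children Ts. inner_integrand G \<phi> (child Ts c) (q @ [c]) w y) \<partial>(Pi\<^sub>M ?K (\<lambda>_. ?S))) =
      (\<Prod>c\<in>children Ts. iterated_value \<delta> G \<phi> (child Ts c) w)"
    if "rapid_kernel \<delta> G" "\<And>a. \<phi> a \<in> M_b \<delta>" "w \<in> spacetime \<delta>" for G \<phi> w
  proof -
    have *: "integrable (Pi\<^sub>M (?B c) (\<lambda>_. ?S)) (inner_integrand G \<phi> (child Ts c) (q @ [c]) w)"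
      "(\<integral>y. inner_integrand G \<phi> (child Ts c) (q @ [c]) w y \<partial>Pi\<^sub>M (?B c) (\<lambda>_. ?S)) = iterated_value \<delta> G \<phi> (child Ts c) w"
      if c: "c \<in> children Ts" for c
      using Inner.IH[OF c \<open>rapid_kernel \<delta> G\<close> \<open>\<And>a. \<phi> a \<in> M_b \<delta>\<close> \<open>w \<in> spacetime \<delta>\<close>, of "q @ [c]"] by auto
    have **: "inner_integrand G \<phi> (child Ts c) (q @ [c]) w y = inner_integrand G \<phi> (child Ts c) (q @ [c]) w y'"
      if "\<And>i. i \<in> ?B c \<Longrightarrow> y i = y' i" for c y y'
      using that by (intro inner_integrand_cong) blast
    show "integrable (Pi\<^sub>M ?K (\<lambda>_. ?S)) (\<lambda>y. \<Prod>c\<in>children Ts. inner_integrand G \<phi> (child Ts c) (q @ [c]) w y)"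
      by (rule st_prod.integrable_prod_blocks[OF finite_children _ disj *(1) **]) auto
    have "(\<integral>y. (\<Prod>c\<in>children Ts. inner_integrand G \<phi> (child Ts c) (q @ [c]) w y) \<partial>(Pi\<^sub>M ?K (\<lambda>_. ?S))) =
      (\<Prod>c\<in>children Ts. \<integral>y. inner_integrand G \<phi> (child Ts c) (q @ [c]) w y \<partial>Pi\<^sub>M (?B c) (\<lambda>_. ?S))"
      by (rule st_prod.integral_prod_blocks[OF finite_children _ disj *(1) **]) auto
    also have "\<dots> = (\<Prod>c\<in>children Ts. iterated_value \<delta> G \<phi> (child Ts c) w)"
      by (rule prod.cong[OF refl *(2)])
    finally show "(\<integral>y. (\<Prod>c\<in>children Ts. inner_integrand G \<phi> (child Ts c) (q @ [c]) w y) \<partial>(Pi\<^sub>M ?K (\<lambda>_. ?S))) =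
      (\<Prod>c\<in>children Ts. iterated_value \<delta> G \<phi> (child Ts c) w)" .
  qed
  have int_conv: "integrable ?S (\<lambda>w. G (x - w) * (\<Prod>c\<in>children Ts. iterated_value \<delta> G \<phi> (child Ts c) w))"
    if "rapid_kernel \<delta> G" "\<And>a. \<phi> a \<in> M_b \<delta>" for G \<phi>
    using that by (intro integrable_conv[OF that(1) _ Inner.prems(3)] M_b_prod[OF that(2)] iterated_value_M_b)
  have meas: "inner_integrand G \<phi> (Inner Ts) q x \<in> borel_measurable (Pi\<^sub>M (insert q ?K) (\<lambda>_. ?S))"
  proof (rule measurable_inner_integrand[where X = "\<lambda>_. x" and Y = "\<lambda>y. y"])
    show "(\<lambda>y. y (q @ u)) \<in> Pi\<^sub>M (insert q ?K) (\<lambda>_. ?S) \<rightarrow>\<^sub>M ?S" if "u \<in> inner_vertices (Inner Ts)" for u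
      using that unfolding index[symmetric] by (intro measurable_component_singleton) auto
  qed (use Inner.prems in \<open>auto simp: rapid_kernel_def M_b_def\<close>)
  have int: "integrable (Pi\<^sub>M (insert q ?K) (\<lambda>_. ?S)) (inner_integrand G \<phi> (Inner Ts) q x)"
  proof (rule integrableI_bounded)
    \<comment> \<open>Tonelli with the variable at q outermost: the inner integral is given by the
      induction hypothesis for the absolute values, and the outer one is a convolution of |G| with a
      function in \<open>M_b\<close>, which is finite.\<close>
    let ?G = "\<lambda>x. \<bar>G x\<bar>" and ?\<phi> = "\<lambda>a x. \<bar>\<phi> a x\<bar>"
    have abs: "rapid_kernel \<delta> ?G" "?\<phi> a \<in> M_b \<delta>" for a
      using Inner.prems by (auto intro: rapid_kernel_abs M_b_abs)
    have "(\<integral>\<^sup>+y. norm (inner_integrand G \<phi> (Inner Ts) q x y) \<partial>Pi\<^sub>M (insert q ?K) (\<lambda>_. ?S))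
      = (\<integral>\<^sup>+w. \<integral>\<^sup>+y. norm (inner_integrand G \<phi> (Inner Ts) q x (y(q := w))) \<partial>Pi\<^sub>M ?K (\<lambda>_. ?S) \<partial>?S)"
      using meas by (intro st_prod.product_nn_integral_insert_rev finK q) measurable
    also have "\<dots> = (\<integral>\<^sup>+w. ennreal (\<bar>G (x - w)\<bar> * (\<Prod>c\<in>children Ts. iterated_value \<delta> ?G ?\<phi> (child Ts c) w)) \<partial>?S)"
    proof (intro nn_integral_cong)
      fix w assume "w \<in> space ?S"
      then have w: "w \<in> spacetime \<delta>" by simp
      have "(\<integral>\<^sup>+y. norm (inner_integrand G \<phi> (Inner Ts) q x (y(q := w))) \<partial>Pi\<^sub>M ?K (\<lambda>_. ?S)) =
        (\<integral>\<^sup>+y. ennreal (\<bar>G (x - w)\<bar> * (\<Prod>c\<in>children Ts. inner_integrand ?G ?\<phi> (child Ts c) (q @ [c]) w y)) \<partial>Pi\<^sub>M ?K (\<lambda>_. ?S))"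
        by (simp add: inner_integrand_Inner upd inner_integrand_abs abs_mult abs_prod)
      also have "\<dots> = ennreal (\<integral>y. \<bar>G (x - w)\<bar> * (\<Prod>c\<in>children Ts. inner_integrand ?G ?\<phi> (child Ts c) (q @ [c]) w y) \<partial>Pi\<^sub>M ?K (\<lambda>_. ?S))"
        by (intro nn_integral_eq_integral integrable_mult_right blocks(1) abs w)
          (auto simp: inner_integrand_abs intro!: AE_I2 mult_nonneg_nonneg prod_nonneg)
      also have "\<dots> = ennreal (\<bar>G (x - w)\<bar> * (\<Prod>c\<in>children Ts. iterated_value \<delta> ?G ?\<phi> (child Ts c) w))"
        by (simp only: integral_mult_right_zero blocks(2)[OF abs w])
      finally show "(\<integral>\<^sup>+y. norm (inner_integrand G \<phi> (Inner Ts) q x (y(q := w))) \<partial>Pi\<^sub>M ?K (\<lambda>_. ?S)) =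
        ennreal (\<bar>G (x - w)\<bar> * (\<Prod>c\<in>children Ts. iterated_value \<delta> ?G ?\<phi> (child Ts c) w))" .
    qed
    also have "\<dots> \<le> (\<integral>\<^sup>+w. norm (\<bar>G (x - w)\<bar> * (\<Prod>c\<in>children Ts. iterated_value \<delta> ?G ?\<phi> (child Ts c) w)) \<partial>?S)"
      by (intro nn_integral_mono) (simp add: ennreal_leI)
    also have "\<dots> < \<infinity>"
      using int_conv[OF abs] by (simp add: integrable_iff_bounded)
    finally show "(\<integral>\<^sup>+y. norm (inner_integrand G \<phi> (Inner Ts) q x y) \<partial>Pi\<^sub>M (insert q ?K) (\<lambda>_. ?S)) < \<infinity>" .
  qed (fact meas)
  have "(\<integral>y. inner_integrand G \<phi> (Inner Ts) q x y \<partial>Pi\<^sub>M (insert q ?K) (\<lambda>_. ?S)) =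
    (\<integral>v. \<integral>y. inner_integrand G \<phi> (Inner Ts) q x (merge {q} ?K (v, y)) \<partial>Pi\<^sub>M ?K (\<lambda>_. ?S) \<partial>Pi\<^sub>M {q} (\<lambda>_. ?S))"
    using st_prod.product_integral_fold[of "{q}" ?K \<delta> "inner_integrand G \<phi> (Inner Ts) q x"] q finK int by simp
  also have "\<dots> = (\<integral>v. G (x - v q) * (\<Prod>c\<in>children Ts. iterated_value \<delta> G \<phi> (child Ts c) (v q)) \<partial>Pi\<^sub>M {q} (\<lambda>_. ?S))"
  proof (intro Bochner_Integration.integral_cong refl)
    fix v assume "v \<in> space (Pi\<^sub>M {q} (\<lambda>_. ?S))"
    then have v: "v q \<in> spacetime \<delta>" by (auto simp: space_PiM PiE_iff)
    have "inner_integrand G \<phi> (Inner Ts) q x (merge {q} ?K (v, y)) =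
      G (x - v q) * (\<Prod>c\<in>children Ts. inner_integrand G \<phi> (child Ts c) (q @ [c]) (v q) y)" for y
    proof -
      have "inner_integrand G \<phi> (child Ts c) (q @ [c]) (v q) (merge {q} ?K (v, y)) = inner_integrand G \<phi> (child Ts c) (q @ [c]) (v q) y"
        if "c \<in> children Ts" for c
        using that by (intro inner_integrand_cong) (auto simp: merge_def)
      then show ?thesis by (simp add: inner_integrand_Inner merge_def[of "{q}"])
    qed
    then show "(\<integral>y. inner_integrand G \<phi> (Inner Ts) q x (merge {q} ?K (v, y)) \<partial>Pi\<^sub>M ?K (\<lambda>_. ?S)) =
      G (x - v q) * (\<Prod>c\<in>children Ts. iterated_value \<delta> G \<phi> (child Ts c) (v q))"
      by (simp only: integral_mult_right_zero blocks(2)[OF Inner.prems(1,2) v])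
  qed
  also have "\<dots> = (\<integral>w. G (x - w) * (\<Prod>c\<in>children Ts. iterated_value \<delta> G \<phi> (child Ts c) w) \<partial>?S)"
    using int_conv[OF Inner.prems(1,2)] by (intro st_prod.product_integral_singleton borel_measurable_integrable)
  also have "\<dots> = iterated_value \<delta> G \<phi> (Inner Ts) x"
    by (simp only: iterated_value_Inner conv_def)
  finally show ?case using int unfolding index by simp
qed

subsection \<open>Integrating over the leaves of type two\<close>

text \<open>A leaf of type two with its variable integrated out, for a general kernel so that |G|
  and |f| can be inserted.\<close>

definition initial_value ::
  "real \<Rightarrow> (real \<times> (real^'d) \<Rightarrow> real) \<Rightarrow> (real^'d \<Rightarrow> real) \<Rightarrow> real \<times> (real^'d) \<Rightarrow> real" where
  "initial_value \<delta> G f x = (\<integral>z. G (x - (0, z)) * f z \<partial>lat_measure \<delta>)"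

text \<open>The leaf sits at time 0, so the elapsed time is t; for t \<le> 0 the right side vanishes
  through the cutoff in \<open>green\<close>.\<close>

lemma initial_part_eq_initial_value: "initial_part \<delta> m0 f = initial_value \<delta> (green \<delta> m0) f"
  by (auto simp: initial_part_def initial_value_def lat_conv_def green_def fun_eq_iff)

lemma measurable_time_zero: "(\<lambda>z. (0, z)) \<in> lat_measure \<delta> \<rightarrow>\<^sub>M (spacetime_measure \<delta> :: (real \<times> (real^'d)) measure)"
  unfolding spacetime_measure_def by measurable

lemma time_zero_in_spacetime: "z \<in> lat \<delta> \<Longrightarrow> (0, z) \<in> spacetime \<delta>"
  by (simp add: spacetime_def)

text \<open>The decay of the kernel with exponent 0 is a uniform bound, so integrability of f bounds
  the initial value uniformly in x.\<close>

lemma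
  fixes G W :: "real \<times> (real^'d) \<Rightarrow> real"
  assumes G: "rapid_kernel \<delta> G" and f: "integrable (lat_measure \<delta>) f"
  shows integrable_initial_value: "x \<in> spacetime \<delta> \<Longrightarrow> integrable (lat_measure \<delta>) (\<lambda>z. G (x - (0, z)) * f z)"
    and M_b_initial_value: "W \<in> M_b \<delta> \<Longrightarrow> initial_value \<delta> G f \<in> M_b \<delta>"
proof -
  note [measurable] = borel_measurable_integrable[OF f] measurable_time_zero
  have [measurable]: "G \<in> borel_measurable (spacetime_measure \<delta>)" using G by (simp add: rapid_kernel_def)
  obtain C where "\<And>x. x \<in> spacetime \<delta> \<Longrightarrow> \<bar>G x\<bar> \<le> C / (1 + (norm x)\<^sup>2) ^ 0"
    using G unfolding rapid_kernel_def by blast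
  then have C: "\<bar>G x\<bar> \<le> C" if "x \<in> spacetime \<delta>" for x using that by simp
  have bound: "\<bar>G (x - (0, z)) * f z\<bar> \<le> C * \<bar>f z\<bar>" if "x \<in> spacetime \<delta>" "z \<in> lat \<delta>" for x z
    using C[OF diff_in_spacetime[OF that(1) time_zero_in_spacetime[OF that(2)]]]
    by (simp add: abs_mult mult_right_mono)
  show int: "integrable (lat_measure \<delta>) (\<lambda>z. G (x - (0, z)) * f z)" if x: "x \<in> spacetime \<delta>" for x
  proof (rule Bochner_Integration.integrable_bound)
    show "integrable (lat_measure \<delta>) (\<lambda>z. C * \<bar>f z\<bar>)" using f by simp
    have [measurable]: "(\<lambda>_. x) \<in> lat_measure \<delta> \<rightarrow>\<^sub>M spacetime_measure \<delta>" using x by simp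
    show "(\<lambda>z. G (x - (0, z)) * f z) \<in> borel_measurable (lat_measure \<delta>)" by measurable
    show "AE z in lat_measure \<delta>. norm (G (x - (0, z)) * f z) \<le> norm (C * \<bar>f z\<bar>)"
      using bound[OF x] by (intro AE_I2) (simp only: space_lat_measure real_norm_def order_trans[OF _ abs_ge_self])
  qed
  show "initial_value \<delta> G f \<in> M_b \<delta>" if W: "W \<in> M_b \<delta>"
  proof (rule M_b_poly_bound[OF W])
    show "initial_value \<delta> G f \<in> borel_measurable (spacetime_measure \<delta>)"
      unfolding initial_value_def[abs_def] by measurable
    fix x :: "real \<times> (real^'d)" assume x: "x \<in> spacetime \<delta>"
    have "\<bar>initial_value \<delta> G f x\<bar> \<le> (\<integral>z. norm (G (x - (0, z)) * f z) \<partial>lat_measure \<delta>)"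
      unfolding initial_value_def using integral_norm_bound[of "lat_measure \<delta>" "\<lambda>z. G (x - (0, z)) * f z"] by simp
    also have "\<dots> \<le> (\<integral>z. C * \<bar>f z\<bar> \<partial>lat_measure \<delta>)"
      using bound[OF x] f by (intro integral_mono integrable_norm int x) auto
    finally show "\<bar>initial_value \<delta> G f x\<bar> \<le> (\<integral>z. C * \<bar>f z\<bar> \<partial>lat_measure \<delta>) * (1 + (norm x)\<^sup>2) ^ 0" by simp
  qed
qed

text \<open>Summability of the weight over the lattice is read off from its integrability over
  space-time, which \<open>W\<close> in \<open>M_b\<close> provides: by Fubini the weight is
  summable on almost every time slice, and one slice suffices.\<close>

lemma integrable_rapidly_decreasing:
  fixes W :: "real \<times> (real^'d) \<Rightarrow> real" and f :: "real^'d \<Rightarrow> real"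
  assumes W: "W \<in> M_b \<delta>" and f: "rapidly_decreasing \<delta> f"
  shows "integrable (lat_measure \<delta>) f"
proof -
  have "\<exists>N. integrable (spacetime_measure \<delta>) (\<lambda>x. \<bar>W x\<bar> ^ 0 / (1 + (norm x)\<^sup>2) ^ N)"
    using W unfolding M_b_def by blast
  then obtain N where "integrable (spacetime_measure \<delta>) (\<lambda>x::real \<times> (real^'d). 1 / (1 + (norm x)\<^sup>2) ^ N)"
    by auto
  then have "AE t in lborel. integrable (lat_measure \<delta>) (\<lambda>z::real^'d. 1 / (1 + (norm (t :: real, z))\<^sup>2) ^ N)"
    unfolding spacetime_measure_def by (rule time_lat.AE_integrable_fst')
  \<comment> \<open>The time axis is not a null set, so a good time t exists.\<close>
  moreover have "ae_filter (lborel :: real measure) \<noteq> bot"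
    by (simp add: ae_filter_eq_bot_iff)
  ultimately obtain t :: real where t: "integrable (lat_measure \<delta>) (\<lambda>z::real^'d. 1 / (1 + (norm (t, z))\<^sup>2) ^ N)"
    using eventually_happens' by blast
  have "bounded ((\<lambda>x. (1 + (norm x)\<^sup>2) ^ N * f x) ` lat \<delta>)"
    using f by (simp add: rapidly_decreasing_def)
  then obtain B where B: "\<And>z. z \<in> lat \<delta> \<Longrightarrow> \<bar>(1 + (norm z)\<^sup>2) ^ N * f z\<bar> \<le> B"
    unfolding bounded_iff by auto
  show ?thesis
  proof (rule Bochner_Integration.integrable_bound)
    \<comment> \<open>The factor (1 + t^2)^N compares the weights at times t and 0: 1 + t^2 + |z|^2
      \<le> (1 + t^2) (1 + |z|^2).\<close>
    show "integrable (lat_measure \<delta>) (\<lambda>z::real^'d. B * (1 + t\<^sup>2) ^ N * (1 / (1 + (norm (t, z))\<^sup>2) ^ N))"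
      by (rule integrable_mult_right) (rule t)
    show "f \<in> borel_measurable (lat_measure \<delta>)"
      by (auto simp: measurable_def sets_lat_measure)
    have "\<bar>f z\<bar> \<le> B * (1 + t\<^sup>2) ^ N * (1 / (1 + (norm (t, z))\<^sup>2) ^ N)" if z: "z \<in> lat \<delta>" for z
    proof -
      have "1 + (norm (t, z))\<^sup>2 \<le> (1 + t\<^sup>2) * (1 + (norm z)\<^sup>2)"
        by (simp add: norm_Pair algebra_simps)
      then have "(1 + (norm (t, z))\<^sup>2) ^ N \<le> ((1 + t\<^sup>2) * (1 + (norm z)\<^sup>2)) ^ N"
        by (rule power_mono) simp
      then have "\<bar>f z\<bar> * (1 + (norm (t, z))\<^sup>2) ^ N \<le> \<bar>f z\<bar> * ((1 + t\<^sup>2) ^ N * (1 + (norm z)\<^sup>2) ^ N)"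
        by (intro mult_left_mono) (simp_all only: power_mult_distrib abs_ge_zero)
      also have "\<dots> = (1 + t\<^sup>2) ^ N * \<bar>(1 + (norm z)\<^sup>2) ^ N * f z\<bar>"
        by (simp add: abs_mult abs_of_nonneg[OF less_imp_le[OF weight_pos]] mult_ac)
      also have "\<dots> \<le> (1 + t\<^sup>2) ^ N * B"
        by (intro mult_left_mono B z) simp
      finally show ?thesis
        using weight_pos[of "(t, z)" N] by (simp add: pos_le_divide_eq mult_ac)
    qed
    then show "AE z in lat_measure \<delta>. norm (f z) \<le> norm (B * (1 + t\<^sup>2) ^ N * (1 / (1 + (norm (t, z))\<^sup>2) ^ N))"
      by (intro AE_I2) (simp only: space_lat_measure real_norm_def order_trans[OF _ abs_ge_self])
  qed
qed

lemma parent_position_eq_parent_at: "parent_position x y u = parent_at [] x y u"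
  by (simp add: parent_position_def parent_at_def)

text \<open>Grouping the edge to each leaf of type two with the value of f there makes the last
  factor, for fixed y, a product of functions of a single z-variable.\<close>

lemma tree_integrand_eq:
  "tree_integrand G W f T x (y, z) =
    (\<Prod>u\<in>inner_vertices T. G (parent_at [] x y u - y u)) * (\<Prod>u\<in>leaves Type_One T. W (parent_at [] x y u)) *
    (\<Prod>u\<in>leaves Type_Two T. G (parent_at [] x y u - (0, z u)) * f (z u))"
proof -
  have "(\<Prod>u\<in>inner_vertices T \<union> leaves Type_Two T. G (parent_position x y u - position T y z u)) =
    (\<Prod>u\<in>inner_vertices T. G (parent_at [] x y u - y u)) * (\<Prod>u\<in>leaves Type_Two T. G (parent_at [] x y u - (0, z u)))"
    using leaves_inner_disjoint[of T Type_Two]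
    by (subst prod.union_disjoint)
      (auto simp: position_def parent_position_eq_parent_at intro!: arg_cong2[where f = "(*)"] prod.cong)
  then show ?thesis
    by (simp add: tree_integrand_def prod.distrib parent_position_eq_parent_at mult_ac)
qed

text \<open>The z-variables are integrated first: for fixed y they decouple and leave
  \<open>inner_integrand\<close> with \<open>initial_value\<close> at the leaves of type two, which
  \<open>inner_integral\<close> evaluates.\<close>

lemma tree_integral:
  fixes G :: "real \<times> (real^'d) \<Rightarrow> real"
  assumes G: "rapid_kernel \<delta> G" and W: "W \<in> M_b \<delta>" and f: "integrable (lat_measure \<delta>) f" and x: "x \<in> spacetime \<delta>"
  shows "integrable (tree_measure \<delta> T) (tree_integrand G W f T x)"
    and "(\<integral>yz. tree_integrand G W f T x yz \<partial>tree_measure \<delta> T) =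
      iterated_value \<delta> G (case_leaf_type W (initial_value \<delta> G f)) T x"
proof -
  let ?Y = "\<Pi>\<^sub>M u\<in>inner_vertices T. spacetime_measure \<delta> :: (real \<times> (real^'d)) measure"
  let ?Z = "\<Pi>\<^sub>M u\<in>leaves Type_Two T. lat_measure \<delta> :: (real^'d) measure"
  interpret Y: sigma_finite_measure ?Y by (rule st_prod.sigma_finite) simp
  interpret Z: sigma_finite_measure ?Z by (rule lat_prod.sigma_finite) simp
  interpret YZ: pair_sigma_finite ?Y ?Z ..
  have measure: "tree_measure \<delta> T = ?Y \<Otimes>\<^sub>M ?Z" by (simp add: tree_measure_def)
  have parent: "parent_at [] x y u \<in> spacetime \<delta>"
    if "y \<in> space ?Y" "u \<in> inner_vertices T \<or> u \<in> leaves a T" for y u a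
    using that butlast_inner[OF that(2)] x by (auto simp: parent_at_def space_PiM PiE_iff)
  have \<phi>: "case_leaf_type W (initial_value \<delta> G f) a \<in> M_b \<delta>"
    if "rapid_kernel \<delta> G" "W \<in> M_b \<delta>" "integrable (lat_measure \<delta>) f" for G W f and a
    using that by (cases a) (auto intro: M_b_initial_value)
  have inner_Z: "integrable ?Z (\<lambda>z. tree_integrand G W f T x (y, z)) \<and>
      (\<integral>z. tree_integrand G W f T x (y, z) \<partial>?Z) = inner_integrand G (case_leaf_type W (initial_value \<delta> G f)) T [] x y"
    if G: "rapid_kernel \<delta> G" and f: "integrable (lat_measure \<delta>) f" and y: "y \<in> space ?Y" for G W f y
  proof -
    have 1: "integrable (lat_measure \<delta>) (\<lambda>z. G (parent_at [] x y u - (0, z)) * f z)" if "u \<in> leaves Type_Two T" for u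
      using parent[OF y, of u Type_Two] that by (intro integrable_initial_value G f) auto
    show ?thesis
      unfolding tree_integrand_eq
      using lat_prod.product_integrable_prod[of "leaves Type_Two T" \<delta> "\<lambda>u z. G (parent_at [] x y u - (0, z)) * f z", OF finite_leaves 1]
        lat_prod.product_integral_prod[of "leaves Type_Two T" \<delta> "\<lambda>u z. G (parent_at [] x y u - (0, z)) * f z", OF finite_leaves 1]
      by (simp add: inner_integrand_def initial_value_def)
  qed
  have index: "(@) [] ` inner_vertices T = inner_vertices T" by (simp add: image_def)
  note inner_Y = inner_integral[where q = "[]" and T = T, unfolded index]
  have meas: "tree_integrand G W f T x \<in> borel_measurable (?Y \<Otimes>\<^sub>M ?Z)"
  proof -
    have mG: "G \<in> borel_measurable (spacetime_measure \<delta>)" and mW: "W \<in> borel_measurable (spacetime_measure \<delta>)"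
      and mf: "f \<in> borel_measurable (lat_measure \<delta>)"
      using G W f by (auto simp: rapid_kernel_def M_b_def)
    have y: "(\<lambda>yz. fst yz u) \<in> ?Y \<Otimes>\<^sub>M ?Z \<rightarrow>\<^sub>M spacetime_measure \<delta>" if "u \<in> inner_vertices T" for u
      using that by measurable
    have z: "(\<lambda>yz. snd yz u) \<in> ?Y \<Otimes>\<^sub>M ?Z \<rightarrow>\<^sub>M lat_measure \<delta>" if "u \<in> leaves Type_Two T" for u
      using that by measurable
    have z0: "(\<lambda>yz. (0, snd yz u)) \<in> ?Y \<Otimes>\<^sub>M ?Z \<rightarrow>\<^sub>M spacetime_measure \<delta>" if "u \<in> leaves Type_Two T" for u
      using measurable_compose[OF z[OF that] measurable_time_zero] .
    have p: "(\<lambda>yz. parent_at [] x (fst yz) u) \<in> ?Y \<Otimes>\<^sub>M ?Z \<rightarrow>\<^sub>M spacetime_measure \<delta>"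
      if "u \<in> inner_vertices T \<or> u \<in> leaves a T" for u a
      using y[OF butlast_inner[OF that]] x by (cases "u = []") (auto simp: parent_at_def)
    have "(\<lambda>yz. tree_integrand G W f T x (fst yz, snd yz)) \<in> borel_measurable (?Y \<Otimes>\<^sub>M ?Z)"
      unfolding tree_integrand_eq
      by (intro borel_measurable_times borel_measurable_prod measurable_compose[OF _ mG]
          measurable_compose[OF _ mW] measurable_compose[OF _ mf] measurable_diff_spacetime y z z0 p) auto
    then show ?thesis by simp
  qed
  have int: "integrable (?Y \<Otimes>\<^sub>M ?Z) (tree_integrand G W f T x)"
  proof (rule YZ.Fubini_integrable[OF meas])
    show "AE y in ?Y. integrable ?Z (\<lambda>z. tree_integrand G W f T x (y, z))"
      using inner_Z[OF G f] by (intro AE_I2) auto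
    let ?G = "\<lambda>x. \<bar>G x\<bar>" and ?W = "\<lambda>x. \<bar>W x\<bar>" and ?f = "\<lambda>z. \<bar>f z\<bar>"
    have abs: "rapid_kernel \<delta> ?G" "?W \<in> M_b \<delta>" "integrable (lat_measure \<delta>) ?f"
      using G W f by (auto intro: rapid_kernel_abs M_b_abs)
    have "norm (tree_integrand G W f T x (y, z)) = tree_integrand ?G ?W ?f T x (y, z)" for y z
      by (simp add: tree_integrand_eq abs_mult abs_prod)
    then have "integrable ?Y (\<lambda>y. \<integral>z. norm (tree_integrand G W f T x (y, z)) \<partial>?Z) \<longleftrightarrow>
        integrable ?Y (inner_integrand ?G (case_leaf_type ?W (initial_value \<delta> ?G ?f)) T [] x)"
      using inner_Z[OF abs(1,3)] by (intro Bochner_Integration.integrable_cong) auto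
    then show "integrable ?Y (\<lambda>y. \<integral>z. norm (tree_integrand G W f T x (y, z)) \<partial>?Z)"
      using inner_Y[OF abs(1) \<phi>[OF abs] x] by simp
  qed
  then show "integrable (tree_measure \<delta> T) (tree_integrand G W f T x)" by (simp add: measure)
  have "(\<integral>yz. tree_integrand G W f T x yz \<partial>(?Y \<Otimes>\<^sub>M ?Z)) = (\<integral>y. \<integral>z. tree_integrand G W f T x (y, z) \<partial>?Z \<partial>?Y)"
    using YZ.integral_fst'[OF int] by simp
  also have "\<dots> = (\<integral>y. inner_integrand G (case_leaf_type W (initial_value \<delta> G f)) T [] x y \<partial>?Y)"
    using inner_Z[OF G f] by (intro Bochner_Integration.integral_cong) auto
  also have "\<dots> = iterated_value \<delta> G (case_leaf_type W (initial_value \<delta> G f)) T x"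
    using inner_Y[OF G \<phi>[OF G W f] x] by simp
  finally show "(\<integral>yz. tree_integrand G W f T x yz \<partial>tree_measure \<delta> T) =
      iterated_value \<delta> G (case_leaf_type W (initial_value \<delta> G f)) T x"
    by (simp add: measure)
qed

section \<open>Sums over trees\<close>

definition root_multiplicity :: "nat \<Rightarrow> rtree list list \<Rightarrow> real" where
  "root_multiplicity p Ts = fact p / (fact (count_list (Ts ! 0) (Leaf Type_One)) *
     fact (count_list (Ts ! 0) (Leaf Type_Two)) * (\<Prod>i = 1..<length Ts. fact (length (Ts ! i))))"

lemma multiplicity_Leaf [simp]: "multiplicity p (Leaf a) = 1"
  by (simp add: multiplicity_def)

lemma multiplicity_Inner:
  "multiplicity p (Inner Ts) = root_multiplicity p Ts * (\<Prod>c\<in>children Ts. multiplicity p (child Ts c))"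
proof -
  have v: "vertex_multiplicity p (Inner Ts) (c # u) = vertex_multiplicity p (child Ts c) u" if "c \<in> children Ts" for c u
    using that by (simp add: vertex_multiplicity_def subtree_at_Cons del: subtree_at.simps(3))
  show ?thesis
    unfolding multiplicity_def inner_vertices_Inner
    by (subst prod.insert) (auto simp: prod_UN_Cons v, simp add: vertex_multiplicity_def root_multiplicity_def)
qed

lemma trees_of_order_0: "trees_of_order p 0 = {Leaf Type_One, Leaf Type_Two}"
proof -
  have "is_tree p 0 T \<longleftrightarrow> T = Leaf Type_One \<or> T = Leaf Type_Two" for T
    by (metis (full_types) is_tree.simps leaf_type.exhaust nat.distinct(1))
  then show ?thesis by (auto simp: trees_of_order_def)
qed

text \<open>Single leaves are unordered, so for i = 0 the number k of leaves of type one determines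
  the list; for i \<ge> 1 different lists are different choices.\<close>

definition attached :: "nat \<Rightarrow> nat \<Rightarrow> nat \<Rightarrow> rtree list set" where
  "attached p i m = (if i = 0 then (\<lambda>k. replicate k (Leaf Type_One) @ replicate (m - k) (Leaf Type_Two)) ` {..m}
     else {ts. set ts \<subseteq> trees_of_order p i \<and> length ts = m})"

lemma length_attached: "ts \<in> attached p i m \<Longrightarrow> length ts = m"
  by (auto simp: attached_def split: if_splits)

lemma set_attached: "ts \<in> attached p i m \<Longrightarrow> T \<in> set ts \<Longrightarrow> is_tree p i T"
  by (auto simp: attached_def trees_of_order_def split: if_splits intro: is_tree.Leaf)

definition attachments :: "nat \<Rightarrow> nat \<Rightarrow> (nat \<Rightarrow> nat) \<Rightarrow> (nat \<Rightarrow> rtree list) set" where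
  "attachments p j n = (\<Pi>\<^sub>E i\<in>{..j}. attached p i (n i))"

definition graft :: "nat \<Rightarrow> (nat \<Rightarrow> rtree list) \<Rightarrow> rtree" where
  "graft j g = Inner (map g [0..<Suc j])"

lemma trees_of_order_Suc:
  "trees_of_order p (Suc j) = graft j ` (\<Union>n\<in>occupation_numbers p j. attachments p j n)"
proof (intro equalityI subsetI)
  fix T assume "T \<in> trees_of_order p (Suc j)"
  then obtain Ts k l where T: "T = Inner Ts" "length Ts = Suc j"
    and sums: "(\<Sum>i\<le>j. length (Ts ! i)) = p" "(\<Sum>i\<le>j. i * length (Ts ! i)) = j"
    and sub: "\<forall>i\<le>j. \<forall>T\<in>set (Ts ! i). is_tree p i T"
    and Ts0: "Ts ! 0 = replicate k (Leaf Type_One) @ replicate l (Leaf Type_Two)"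
    unfolding trees_of_order_def by (auto elim: is_tree.cases)
  \<comment> \<open>The occupation numbers are recovered as list lengths, extended by 0 beyond j as
    \<open>occupation_numbers\<close> demands.\<close>
  define n where "n i = (if i \<le> j then length (Ts ! i) else 0)" for i
  define g where "g = restrict (\<lambda>i. Ts ! i) {..j}"
  have "n \<in> occupation_numbers p j" using sums by (simp add: n_def occupation_numbers_def)
  moreover have "Ts ! i \<in> attached p i (n i)" if "i \<le> j" for i
    using that sub by (auto simp: attached_def n_def Ts0 trees_of_order_def intro!: image_eqI[of _ _ k])
  then have "g \<in> attachments p j n" by (auto simp: g_def attachments_def)
  moreover have "T = graft j g"
    using T by (auto simp: graft_def g_def simp del: upt_Suc intro!: nth_equalityI)
  ultimately show "T \<in> graft j ` (\<Union>n\<in>occupation_numbers p j. attachments p j n)" by blast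
next
  fix T assume "T \<in> graft j ` (\<Union>n\<in>occupation_numbers p j. attachments p j n)"
  then obtain n g where n: "n \<in> occupation_numbers p j" and g: "\<And>i. i \<le> j \<Longrightarrow> g i \<in> attached p i (n i)"
    and T: "T = graft j g" by (auto simp: attachments_def PiE_iff)
  have nth: "map g [0..<Suc j] ! i = g i" if "i \<le> j" for i using that by (simp del: upt_Suc)
  obtain k where k: "k \<le> n 0" "g 0 = replicate k (Leaf Type_One) @ replicate (n 0 - k) (Leaf Type_Two)"
    using g[of 0] by (auto simp: attached_def)
  have "is_tree p (Suc j) (Inner (map g [0..<Suc j]))"
  proof (rule is_tree.Inner)
    show "(\<Sum>i\<le>j. length (map g [0..<Suc j] ! i)) = p" "(\<Sum>i\<le>j. i * length (map g [0..<Suc j] ! i)) = j"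
      using n by (auto simp: occupation_numbers_def nth length_attached[OF g] simp del: upt_Suc)
    show "\<forall>i\<le>j. \<forall>T\<in>set (map g [0..<Suc j] ! i). is_tree p i T"
      using set_attached[OF g] by (simp add: nth del: upt_Suc)
    show "map g [0..<Suc j] ! 0 = replicate k (Leaf Type_One) @ replicate (n 0 - k) (Leaf Type_Two)"
      unfolding k(2)[symmetric] by (rule nth) simp
  qed simp
  then show "T \<in> trees_of_order p (Suc j)" by (simp add: trees_of_order_def T graft_def)
qed

lemma finite_occupation_numbers: "finite (occupation_numbers p j)"
proof (rule finite_subset)
  show "occupation_numbers p j \<subseteq> {n. \<forall>i. (i \<in> {..j} \<longrightarrow> n i \<in> {..p}) \<and> (i \<notin> {..j} \<longrightarrow> n i = 0)}"
    by (auto simp: occupation_numbers_def intro: member_le_sum)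
qed (intro finite_set_of_finite_funs; simp)

lemma finite_trees_of_order: "finite (trees_of_order p j)"
proof (induction j rule: less_induct)
  case (less j)
  show ?case
  proof (cases j)
    case 0
    then show ?thesis by (simp add: trees_of_order_0)
  next
    case (Suc k)
    have "finite (attached p i m)" if "i \<le> k" for i m
      using less[of i] that Suc by (auto simp: attached_def finite_lists_length_eq)
    then show ?thesis
      unfolding Suc trees_of_order_Suc attachments_def
      by (intro finite_imageI finite_UN_I finite_occupation_numbers finite_PiE) auto
  qed
qed

lemma finite_attached: "finite (attached p i m)"
  using finite_trees_of_order by (auto simp: attached_def finite_lists_length_eq)

text \<open>No tree is counted twice: the families in \<open>attachments\<close> are extensional,
  hence determined by the grafted tree, and their list lengths determine n.\<close>

lemma sum_trees_of_order_Suc: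
  fixes H :: "rtree \<Rightarrow> real"
  shows "(\<Sum>T\<in>trees_of_order p (Suc j). H T) = (\<Sum>n\<in>occupation_numbers p j. \<Sum>g\<in>attachments p j n. H (graft j g))"
proof -
  let ?U = "\<Union>n\<in>occupation_numbers p j. attachments p j n"
  have "inj_on (graft j) ?U"
  proof (rule inj_onI)
    fix g h assume gh: "g \<in> ?U" "h \<in> ?U" and eq: "graft j g = graft j h"
    have "g i = h i" if "i \<le> j" for i
      using eq that by (auto simp: graft_def simp del: upt_Suc)
    moreover have "g \<in> extensional {..j}" "h \<in> extensional {..j}"
      using gh by (auto simp: attachments_def PiE_def)
    ultimately show "g = h" by (auto intro: extensionalityI)
  qed
  then have "(\<Sum>T\<in>trees_of_order p (Suc j). H T) = (\<Sum>g\<in>?U. H (graft j g))"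
    unfolding trees_of_order_Suc by (simp add: sum.reindex)
  also have "\<dots> = (\<Sum>n\<in>occupation_numbers p j. \<Sum>g\<in>attachments p j n. H (graft j g))"
  proof (intro sum.UNION_disjoint finite_occupation_numbers ballI impI)
    show "finite (attachments p j n)" for n
      unfolding attachments_def by (intro finite_PiE finite_attached) auto
    fix n n' assume n: "n \<in> occupation_numbers p j" "n' \<in> occupation_numbers p j" "n \<noteq> n'"
    have "n = n'" if "g \<in> attachments p j n" "g \<in> attachments p j n'" for g
    proof
      fix i
      show "n i = n' i"
      proof (cases "i \<le> j")
        case True
        then have "g i \<in> attached p i (n i)" "g i \<in> attached p i (n' i)"
          using that by (auto simp: attachments_def)
        then show ?thesis using length_attached by metis
      qed (use n in \<open>simp add: occupation_numbers_def\<close>)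
    qed
    then show "attachments p j n \<inter> attachments p j n' = {}" using n(3) by blast
  qed
  finally show ?thesis .
qed

section \<open>Expansion of powers and multinomial coefficients\<close>

lemma sum_lists_prod_list:
  fixes v :: "'a \<Rightarrow> real"
  assumes "finite A"
  shows "(\<Sum>ts | set ts \<subseteq> A \<and> length ts = m. prod_list (map v ts)) = (\<Sum>T\<in>A. v T) ^ m"
proof (induction m)
  case 0
  have "{ts. set ts \<subseteq> A \<and> length ts = 0} = {[]}" by auto
  then show ?case by simp
next
  case (Suc m)
  let ?L = "{ts. set ts \<subseteq> A \<and> length ts = m}"
  have "{ts. set ts \<subseteq> A \<and> length ts = Suc m} = (\<lambda>(T, ts). T # ts) ` (A \<times> ?L)"
    by (auto simp: length_Suc_conv image_iff)
  moreover have "inj_on (\<lambda>x. fst x # snd x) (A \<times> ?L)" by (auto simp: inj_on_def)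
  ultimately have "(\<Sum>ts | set ts \<subseteq> A \<and> length ts = Suc m. prod_list (map v ts)) = (\<Sum>(T, ts)\<in>A \<times> ?L. v T * prod_list (map v ts))"
    by (simp add: sum.reindex case_prod_beta)
  also have "\<dots> = (\<Sum>T\<in>A. v T) * (\<Sum>ts\<in>?L. prod_list (map v ts))"
    by (simp add: sum.cartesian_product[symmetric] sum_product)
  finally show ?case by (simp add: Suc.IH)
qed

text \<open>The share of index i in the multiplicity of the first inner vertex, with p! left out,
  times the values of the attached trees.\<close>

definition list_weight :: "(rtree \<Rightarrow> real) \<Rightarrow> nat \<Rightarrow> rtree list \<Rightarrow> real" where
  "list_weight v i ts = prod_list (map v ts) /
     (if i = 0 then fact (count_list ts (Leaf Type_One)) * fact (count_list ts (Leaf Type_Two)) else fact (length ts))"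

lemma count_list_replicate: "count_list (replicate k a) b = (if a = b then k else 0)"
  by (induction k) auto

text \<open>For i \<ge> 1 the ordered lists expand the power of the sum. For i = 0 the two
  factorials k! and (m - k)! are those of a binomial coefficient divided by m!, and the binomial
  theorem merges the two leaf types.\<close>

lemma sum_list_weight:
  "(\<Sum>ts\<in>attached p i m. list_weight v i ts) = (\<Sum>T\<in>trees_of_order p i. v T) ^ m / fact m"
proof (cases "i = 0")
  case False
  then have "(\<Sum>ts\<in>attached p i m. list_weight v i ts) = (\<Sum>ts | set ts \<subseteq> trees_of_order p i \<and> length ts = m. prod_list (map v ts) / fact m)"
    by (intro sum.cong) (auto simp: attached_def list_weight_def)
  then show ?thesis
    by (simp add: sum_lists_prod_list[OF finite_trees_of_order] flip: sum_divide_distrib)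
next
  case True
  let ?r = "\<lambda>k. replicate k (Leaf Type_One) @ replicate (m - k) (Leaf Type_Two)"
  let ?a = "v (Leaf Type_One)" and ?b = "v (Leaf Type_Two)"
  have count: "count_list (?r k) (Leaf Type_One) = k" "count_list (?r k) (Leaf Type_Two) = m - k" for k
    by (simp_all add: count_list_replicate)
  have inj: "inj_on ?r {..m}"
    by (rule inj_on_inverseI[where g = "\<lambda>ts. count_list ts (Leaf Type_One)"]) (rule count(1))
  have "(\<Sum>ts\<in>attached p i m. list_weight v i ts) = (\<Sum>k\<le>m. list_weight v 0 (?r k))"
    using True by (simp add: attached_def sum.reindex[OF inj])
  also have "\<dots> = (\<Sum>k\<le>m. real (m choose k) * ?a ^ k * ?b ^ (m - k) / fact m)"
  proof (rule sum.cong[OF refl])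
    fix k assume "k \<in> {..m}"
    then show "list_weight v 0 (?r k) = real (m choose k) * ?a ^ k * ?b ^ (m - k) / fact m"
      unfolding list_weight_def count by (simp add: binomial_fact prod_list_replicate)
  qed
  also have "\<dots> = (?a + ?b) ^ m / fact m"
    by (simp add: binomial_ring sum_divide_distrib)
  finally show ?thesis using True by (simp add: trees_of_order_0)
qed

text \<open>The value 0 at a leaf is a default: the sums run over trees of positive order, all of
  the form \<open>Inner Ts\<close>.\<close>

fun root_weight :: "nat \<Rightarrow> (rtree \<Rightarrow> real) \<Rightarrow> rtree \<Rightarrow> real" where
  "root_weight p v (Leaf a) = 0"
| "root_weight p v (Inner Ts) = root_multiplicity p Ts * prod_list (map (\<lambda>ts. prod_list (map v ts)) Ts)"

lemma root_weight_graft: "root_weight p v (graft j g) = fact p * (\<Prod>i\<le>j. list_weight v i (g i))"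
proof -
  \<comment> \<open>Index 0 is split off because its denominator has one factorial per leaf
    type.\<close>
  have split: "(\<Prod>i\<le>j. h i) = h 0 * (\<Prod>i=1..<Suc j. h i)" for h :: "nat \<Rightarrow> real"
    by (simp add: prod.atLeast_Suc_lessThan flip: atLeast0AtMost atLeastLessThanSuc_atLeastAtMost)
  have "prod_list (map (\<lambda>ts. prod_list (map v ts)) (map g [0..<Suc j])) = (\<Prod>i\<le>j. prod_list (map v (g i)))"
    using prod.distinct_set_conv_list[of "[0..<Suc j]" "\<lambda>i. prod_list (map v (g i))"]
    by (simp add: comp_def atLeast0AtMost atLeastLessThanSuc_atLeastAtMost del: upt_Suc)
  moreover have "(\<Prod>i=1..<Suc j. fact (length (map g [0..<Suc j] ! i))) = (\<Prod>i=1..<Suc j. fact (length (g i)) :: real)"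
    by (rule prod.cong) (simp_all del: upt_Suc)
  moreover have "map g [0..<Suc j] ! 0 = g 0" by (simp del: upt_Suc)
  ultimately have "root_weight p v (graft j g) = fact p * ((\<Prod>i\<le>j. prod_list (map v (g i))) /
      (fact (count_list (g 0) (Leaf Type_One)) * fact (count_list (g 0) (Leaf Type_Two)) * (\<Prod>i=1..<Suc j. fact (length (g i)))))"
    by (simp add: graft_def root_multiplicity_def del: upt_Suc prod.op_ivl_Suc)
  also have "\<dots> = fact p * (\<Prod>i\<le>j. list_weight v i (g i))"
    unfolding list_weight_def prod_dividef split[of "\<lambda>i. if i = 0 then _ i else _ i"] by simp
  finally show ?thesis .
qed

text \<open>Distributivity: the lists for different i are chosen independently, so the sum over
  families is the product over i of the sums in \<open>sum_list_weight\<close>.\<close>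

lemma power_coeff_eq_sum_trees:
  assumes "\<And>i. i \<le> j \<Longrightarrow> X i y = (\<Sum>T\<in>trees_of_order p i. v T)"
  shows "power_coeff p X j y = (\<Sum>T\<in>trees_of_order p (Suc j). root_weight p v T)"
proof -
  have "(\<Sum>g\<in>attachments p j n. root_weight p v (graft j g)) = fact p / (\<Prod>i\<le>j. fact (n i)) * (\<Prod>i\<le>j. X i y ^ n i)" for n
  proof -
    have "(\<Sum>g\<in>attachments p j n. root_weight p v (graft j g)) = fact p * (\<Sum>g\<in>attachments p j n. \<Prod>i\<le>j. list_weight v i (g i))"
      by (simp add: root_weight_graft sum_distrib_left)
    also have "(\<Sum>g\<in>attachments p j n. \<Prod>i\<le>j. list_weight v i (g i)) = (\<Prod>i\<le>j. \<Sum>ts\<in>attached p i (n i). list_weight v i ts)"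
      unfolding attachments_def by (rule prod_sum_PiE[symmetric]) (auto intro: finite_attached)
    also have "\<dots> = (\<Prod>i\<le>j. X i y ^ n i / fact (n i))"
      by (rule prod.cong) (simp_all add: sum_list_weight assms)
    finally show ?thesis by (simp add: prod_dividef)
  qed
  then show ?thesis by (simp add: power_coeff_def sum_trees_of_order_Suc)
qed

section \<open>Comparison of the two recursions\<close>

text \<open>Multiplicities are constants under the integral: that of the first inner vertex enters
  \<open>root_weight\<close>, those of the attached trees go into their values.\<close>

lemma weighted_value_Inner:
  "multiplicity p (Inner Ts) * iterated_value \<delta> G \<phi> (Inner Ts) x =
     conv \<delta> G (\<lambda>y. root_weight p (\<lambda>T. multiplicity p T * iterated_value \<delta> G \<phi> T y) (Inner Ts)) x"
proof -
  have "root_weight p (\<lambda>T. multiplicity p T * iterated_value \<delta> G \<phi> T y) (Inner Ts) =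
    multiplicity p (Inner Ts) * (\<Prod>c\<in>children Ts. iterated_value \<delta> G \<phi> (child Ts c) y)" for y
    by (simp add: prod_list_children multiplicity_Inner prod.distrib)
  then show ?thesis
    unfolding iterated_value_Inner conv_def mult.left_commute[of _ "multiplicity p (Inner Ts)"]
    by (simp only: mult.left_commute[of _ "multiplicity p (Inner Ts)"] integral_mult_right_zero)
qed

lemma power_coeff_M_b:
  fixes W :: "real \<times> (real^'d) \<Rightarrow> real" and f :: "real^'d \<Rightarrow> real"
  assumes G: "rapid_kernel \<delta> (green \<delta> m0 :: real \<times> (real^'d) \<Rightarrow> real)"
    and W: "W \<in> M_b \<delta>" and f: "integrable (lat_measure \<delta>) f"
  shows "power_coeff p (sol_coeff \<delta> m0 p W f) j \<in> M_b \<delta>"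
proof -
  have pow: "power_coeff p X j \<in> M_b \<delta>" if "\<And>i. i \<le> j \<Longrightarrow> X i \<in> M_b \<delta>" for X :: "nat \<Rightarrow> real \<times> (real^'d) \<Rightarrow> real" and j
    unfolding power_coeff_def[abs_def]
    by (intro M_b_sum[OF W] M_b_mult M_b_const[OF W] M_b_prod[OF W] M_b_power that) auto
  have X: "sol_coeff \<delta> m0 p W f j \<in> M_b \<delta>" for j
  proof (induction j rule: less_induct)
    case (less j)
    show ?case
    proof (cases j)
      case 0
      then show ?thesis
        unfolding 0 sol_coeff.simps initial_part_eq_initial_value by (intro M_b_add W M_b_initial_value[OF G f W])
    next
      case (Suc k)
      then show ?thesis
        unfolding Suc sol_coeff.simps by (intro M_b_conv[OF G] pow less) (auto simp: Suc)
    qed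
  qed
  show "power_coeff p (sol_coeff \<delta> m0 p W f) j \<in> M_b \<delta>" by (intro pow X)
qed

lemma sol_coeff_eq_sum_trees:
  fixes W :: "real \<times> (real^'d) \<Rightarrow> real" and f :: "real^'d \<Rightarrow> real"
  assumes G: "rapid_kernel \<delta> (green \<delta> m0 :: real \<times> (real^'d) \<Rightarrow> real)"
    and W: "W \<in> M_b \<delta>" and f: "integrable (lat_measure \<delta>) f" and x: "x \<in> spacetime \<delta>"
  shows "sol_coeff \<delta> m0 p W f j x = (\<Sum>T\<in>trees_of_order p j. tree_value \<delta> m0 p W f T x)"
proof -
  define \<phi> where "\<phi> = case_leaf_type W (initial_value \<delta> (green \<delta> m0) f)"
  define v where "v T y = multiplicity p T * iterated_value \<delta> (green \<delta> m0) \<phi> T y" for T y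
  have \<phi>: "\<phi> a \<in> M_b \<delta>" for a
    using W M_b_initial_value[OF G f W] by (cases a) (auto simp: \<phi>_def)
  have v: "v T \<in> M_b \<delta>" for T
    unfolding v_def[abs_def] by (intro M_b_mult M_b_const[OF W] iterated_value_M_b G \<phi>)
  have root: "(\<lambda>y. root_weight p (\<lambda>T. v T y) T) \<in> M_b \<delta>" for T
    by (cases T) (auto intro!: M_b_mult M_b_const[OF W] M_b_prod_list[OF W] v)
  have "sol_coeff \<delta> m0 p W f j x = (\<Sum>T\<in>trees_of_order p j. v T x)"
    using x
  proof (induction j arbitrary: x rule: less_induct)
    case (less j)
    show ?case
    proof (cases j)
      case 0
      then show ?thesis
        by (simp add: trees_of_order_0 v_def \<phi>_def initial_part_eq_initial_value)
    next
      case (Suc k)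
      have "sol_coeff \<delta> m0 p W f j x = (\<integral>y. green \<delta> m0 (x - y) * power_coeff p (sol_coeff \<delta> m0 p W f) k y \<partial>spacetime_measure \<delta>)"
        by (simp add: Suc conv_def)
      also have "\<dots> = (\<integral>y. (\<Sum>T\<in>trees_of_order p j. green \<delta> m0 (x - y) * root_weight p (\<lambda>T. v T y) T) \<partial>spacetime_measure \<delta>)"
      proof (rule Bochner_Integration.integral_cong[OF refl])
        fix y :: "real \<times> (real^'d)" assume "y \<in> space (spacetime_measure \<delta>)"
        \<comment> \<open>The induction hypothesis covers points of space-time only, and the
          integration variable stays there.\<close>
        then have "power_coeff p (sol_coeff \<delta> m0 p W f) k y = (\<Sum>T\<in>trees_of_order p j. root_weight p (\<lambda>T. v T y) T)"
          unfolding Suc by (intro power_coeff_eq_sum_trees less.IH) (auto simp: Suc)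
        then show "green \<delta> m0 (x - y) * power_coeff p (sol_coeff \<delta> m0 p W f) k y =
          (\<Sum>T\<in>trees_of_order p j. green \<delta> m0 (x - y) * root_weight p (\<lambda>T. v T y) T)"
          by (simp add: sum_distrib_left)
      qed
      also have "\<dots> = (\<Sum>T\<in>trees_of_order p j. conv \<delta> (green \<delta> m0) (\<lambda>y. root_weight p (\<lambda>T. v T y) T) x)"
        unfolding conv_def
        by (rule Bochner_Integration.integral_sum) (rule integrable_conv[OF G root less.prems])
      also have "\<dots> = (\<Sum>T\<in>trees_of_order p j. v T x)"
      proof (rule sum.cong[OF refl])
        fix T assume "T \<in> trees_of_order p j"
        then obtain Ts where "T = Inner Ts"
          by (auto simp: Suc trees_of_order_Suc graft_def)
        then show "conv \<delta> (green \<delta> m0) (\<lambda>y. root_weight p (\<lambda>T. v T y) T) x = v T x"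
          unfolding v_def by (simp only: weighted_value_Inner)
      qed
      finally show ?thesis .
    qed
  qed
  then show ?thesis
    using tree_integral(2)[OF G W f x] by (simp add: v_def \<phi>_def tree_value_def)
qed

text \<open>Integrability and finiteness belong to the conclusion because a divergent integral or an
  infinite sum would have the default value 0.\<close>

theorem theorem3p5:
  fixes \<delta> m0 :: real and p :: nat
    and f :: "real^'d \<Rightarrow> real"
    and M :: "'w measure"
    and \<eta> :: "'w \<Rightarrow> (real \<times> (real^'d) \<Rightarrow> real) \<Rightarrow> real"
    and G\<eta> :: "'w \<Rightarrow> real \<times> (real^'d) \<Rightarrow> real"
  assumes "p \<ge> 1" and "\<delta> > 0" and "m0 > 0"
    and "rapidly_decreasing \<delta> f"
    and "prob_space M"
    and "random_tempered_distribution M \<delta> \<eta>"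
    and "\<forall>\<omega>\<in>space M. supported_in_nonneg_times \<delta> (\<eta> \<omega>)"
    and "AE \<omega> in M. G\<eta> \<omega> \<in> M_b \<delta> \<and> is_green_conv \<delta> m0 (\<eta> \<omega>) (G\<eta> \<omega>)"
  shows "AE \<omega> in M. \<forall>j. \<forall>x\<in>spacetime \<delta>.
      integrable (spacetime_measure \<delta>)
        (\<lambda>y. green \<delta> m0 (x - y) * power_coeff p (sol_coeff \<delta> m0 p (G\<eta> \<omega>) f) j y) \<and>
      finite (trees_of_order p j) \<and>
      (\<forall>T\<in>trees_of_order p j. integrable (tree_measure \<delta> T)
        (tree_integrand (green \<delta> m0) (G\<eta> \<omega>) f T x)) \<and>
      sol_coeff \<delta> m0 p (G\<eta> \<omega>) f j x = (\<Sum>T\<in>trees_of_order p j. tree_value \<delta> m0 p (G\<eta> \<omega>) f T x)"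
  using assms(8)
proof eventually_elim
  case (elim \<omega>)
  note G = green_rapid_kernel[OF assms(2,3), where 'd = 'd]
  have W: "G\<eta> \<omega> \<in> M_b \<delta>" using elim by simp
  note f = integrable_rapidly_decreasing[OF W assms(4)]
  show ?case
    by (intro allI ballI conjI finite_trees_of_order sol_coeff_eq_sum_trees[OF G W f] tree_integral(1)[OF G W f]
        integrable_conv[OF G power_coeff_M_b[OF G W f]])
qed

end
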